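(* Let $m_{-2}\ge m_{-1}\ge 0$ be integers and let $$\begin{pmatrix} m_{-2} && m_{-1} &&0 &&\\ &k_{-2}&& k_{-1} &&\\ &&h_{-2}&&0\\ &&&h_{-1}\end{pmatrix}$$ be a Gelfand-Tsetlin diagram for $\mathfrak{sp}_4$, i.e. an integer diagram satisfying the betweenness conditions $m_{-2}\ge k_{-2}\ge m_{-1}\ge k_{-1}\ge 0$, $k_{-2}\ge h_{-2}\ge k_{-1}$, $h_{-2}\ge h_{-1}\ge 0$. Then the Gelfand-Tsetlin-Zhelobenko base vector corresponding to this diagram (a function on $Sp_4$, defined up to a nonzero scalar; see context) equals, up to a nonzero scalar, the function on $Sp_4$ given by the $\Gamma$-series $$\sum_{p}\ \prod_{X}\frac{a_X^{p_X}}{\Gamma(p_X+1)}$$ in the nine determinants $a_X$, $$X\in S=\{\,(-2),\ (-1),\ (1),\ (2),\ (-2,-1),\ (-2,1),\ (2,-1),\ (2,1),\ (-1,1)\,\},$$ where the sum is over all $p=(p_X)_{X\in S}\in\mathbb{Z}^9$ in the shifted lattice defined by the six equations: (1) the sum of all $p_X$, $X \in S$, equals $m_{-2}$; (2) the sum of $p_X$ over all $X\in S$ consisting of two indices equals $m_{-1}$; (3) the sum of $p_X$ over all $X\in S$ that contain at least one of the indices $-2,2,-1$ equals $k_{-2}$; (4) $p_{(-2,-1)}+p_{(2,-1)}=k_{-1}$; (5) the sum of $p_X$ over all $X\in S$ that contain $-2$ or $2$ equals $h_{-2}$; (6) the sum of $p_X$ over all $X\in S$ that contain $-2$ equals $h_{-1}$.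 (Here $1/\Gamma(n+1)=0$ for negative integers $n$, so only terms with all $p_X\ge 0$ contribute.)
   Context: Everything is over $\mathbb{C}$. Rows and columns of $4\times4$ matrices are indexed by $-2,-1,1,2$, and $E_{i,j}$ are the matrix units. The Lie algebra $\mathfrak{sp}_4$ is spanned by $F_{i,j}=E_{i,j}-\mathrm{sign}(i)\,\mathrm{sign}(j)\,E_{-j,-i}$, $i,j\in\{-2,-1,1,2\}$; $\mathfrak{sp}_2$ is the subalgebra spanned by $F_{i,j}$, $i,j\in\{-2,2\}$; $Sp_4\subset GL_4$ is the corresponding connected group. Rows and columns of $3\times 3$ matrices are indexed by $-2,-1,1$, and $\mathfrak{gl}_3\supset\mathfrak{gl}_2\supset\mathfrak{gl}_1$ is the chain of subalgebras spanned by the $E_{i,j}$ with indices in $\{-2,-1,1\}$, $\{-2,-1\}$, $\{-2\}$ respectively. A group $G$ ($=GL_3$ or $Sp_4$) acts on functions on $G$ by right shifts $(Xf)(g)=f(gX)$, and its Lie algebra acts by the corresponding infinitesimal action. Let $a_i^j$ be the matrix-element function on $G$, with $j$ the row label and $i$ the column label. Put $a_i=a_i^{-2}$ and $a_{i_1,i_2}=a_{i_1}^{-2}a_{i_2}^{-1}-a_{i_2}^{-2}a_{i_1}^{-1}$ (the minor on rows $-2,-1$ and columns $i_1,i_2$). The function $v_0=a_{-2}^{m_{-2}-m_{-1}}a_{-2,-1}^{m_{-1}}$ is a highest vector of weight $[m_{-2},m_{-1},0]$ for $\mathfrak{gl}_3$ (on $GL_3$) and of weight $[m_{-2},m_{-1}]$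 for $\mathfrak{sp}_4$ (on $Sp_4$), and it generates the corresponding irreducible finite-dimensional representation. Gelfand-Tsetlin-Zhelobenko base vectors for $\mathfrak{sp}_4$ are defined as follows. Step 1: in the irreducible $\mathfrak{gl}_3$-representation generated by $v_0$ on $GL_3$, take the Gelfand-Tsetlin vector $w$ with diagram having rows $(m_{-2},m_{-1},0)$, $(k_{-2},k_{-1})$, $(h_{-2})$: the vector, unique up to a nonzero scalar, lying in the $\mathfrak{gl}_2$-irreducible component of highest weight $[k_{-2},k_{-1}]$ and having $\mathfrak{gl}_1$-weight (eigenvalue of $E_{-2,-2}$) equal to $h_{-2}$. Step 2: write $w$ as a polynomial in the functions $a_{-2},a_{-1},a_1,a_{-2,-1},a_{-2,1},a_{-1,1}$ on $GL_3$, and take the same polynomial in the functions $a_{-2},a_{-1},a_1,a_{-2,-1},a_{-2,1},a_{-1,1}$ on $Sp_4$; the result is an $\mathfrak{sp}_2$-highest vector of weight $[h_{-2}]$ in the irreducible $\mathfrak{sp}_4$-representation with highest weight $[m_{-2},m_{-1}]$. Step 3: apply to it the operator $\dfrac{F_{2,-2}^{\,h_{-2}-h_{-1}}}{(h_{-2}-h_{-1})!}$. The resulting function on $Sp_4$ is the base vector corresponding to the $\mathfrak{sp}_4$-diagram. *)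

theory Defs
  imports "HOL-Analysis.Analysis" "HOL-Library.Poly_Mapping" "HOL-Library.Function_Algebras"
begin

section \<open>Index sets\<close>

text \<open>
  The labels \<open>-2, -1, 1, 2\<close> of the rows and columns of \<open>4 \<times> 4\<close> matrices are the
  constructors \<open>N2, N1, P1, P2\<close>; the labels \<open>-2, -1, 1\<close> of \<open>3 \<times> 3\<close> matrices are
  \<open>N2', N1', P1'\<close>.  The latter set is embedded in the former by \<open>incl\<close>.
\<close>

datatype idx4 = N2 | N1 | P1 | P2
datatype idx3 = N2' | N1' | P1'

lemma UNIV_idx4: "UNIV = {N2, N1, P1, P2}"
  using idx4.exhaust by auto

lemma UNIV_idx3: "UNIV = {N2', N1', P1'}"
  using idx3.exhaust by auto

instance idx4 :: finite
  by standard (simp add: UNIV_idx4)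

instance idx3 :: finite
  by standard (simp add: UNIV_idx3)

fun incl :: "idx3 \<Rightarrow> idx4" where
  "incl N2' = N2"
| "incl N1' = N1"
| "incl P1' = P1"

fun neg_idx :: "idx4 \<Rightarrow> idx4" where
  "neg_idx N2 = P2"
| "neg_idx N1 = P1"
| "neg_idx P1 = N1"
| "neg_idx P2 = N2"

fun sign_idx :: "idx4 \<Rightarrow> complex" where
  "sign_idx N2 = -1"
| "sign_idx N1 = -1"
| "sign_idx P1 = 1"
| "sign_idx P2 = 1"


section \<open>Matrices, Lie algebras and groups\<close>

definition smat :: "complex \<Rightarrow> complex^'n^'n \<Rightarrow> complex^'n^'n" where
  "smat c A = (\<chi> i j. c * A $ i $ j)"

global_interpretation cmat: vector_space smat
  by standard (simp_all add: smat_def vec_eq_iff algebra_simps)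

definition Emat :: "'n \<Rightarrow> 'n \<Rightarrow> complex^'n^'n" where
  "Emat i j = (\<chi> r c. if r = i \<and> c = j then 1 else 0)"

definition Fmat :: "idx4 \<Rightarrow> idx4 \<Rightarrow> complex^idx4^idx4" where
  "Fmat i j = Emat i j - smat (sign_idx i * sign_idx j) (Emat (neg_idx j) (neg_idx i))"

definition gl :: "'n set \<Rightarrow> (complex^'n^'n) set" where
  "gl I = cmat.span {Emat i j | i j. i \<in> I \<and> j \<in> I}"

definition sp4 :: "(complex^idx4^idx4) set" where
  "sp4 = cmat.span {Fmat i j | i j. True}"

text \<open>
  The product on the type \<open>complex^'n^'n\<close> is componentwise, so the powers in the
  exponential series are iterates of \<open>(**)\<close>.
\<close>

definition mexp :: "complex^'n^'n \<Rightarrow> complex^'n^'n" where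
  "mexp A = (\<chi> i j. suminf (\<lambda>n. (((**) A) ^^ n) (mat 1) $ i $ j / fact n))"

definition GL3 :: "(complex^idx3^idx3) set" where
  "GL3 = {g. invertible g}"

text \<open>
  The connected Lie group with Lie algebra \<open>sp4\<close> is the subgroup generated by the
  exponentials; the generating set is closed under inverses since \<open>mexp (- X)\<close> is the
  inverse of \<open>mexp X\<close>.
\<close>

inductive_set Sp4 :: "(complex^idx4^idx4) set" where
  one: "mat 1 \<in> Sp4"
| mult_exp: "g \<in> Sp4 \<Longrightarrow> X \<in> sp4 \<Longrightarrow> g ** mexp X \<in> Sp4"


section \<open>Functions on a group and the right-shift action\<close>

text \<open>
  A function on a group \<open>G\<close> of matrices is represented by a function on all matrices that
  vanishes outside \<open>G\<close>, so that equality of functions on \<open>G\<close> is equality in HOL.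
\<close>

definition on_group :: "'g set \<Rightarrow> ('g \<Rightarrow> complex) \<Rightarrow> 'g \<Rightarrow> complex" where
  "on_group G f = (\<lambda>g. if g \<in> G then f g else 0)"

definition sfun :: "complex \<Rightarrow> ('g \<Rightarrow> complex) \<Rightarrow> 'g \<Rightarrow> complex" where
  "sfun c f = (\<lambda>g. c * f g)"

global_interpretation cfun: vector_space "sfun :: complex \<Rightarrow> ('g \<Rightarrow> complex) \<Rightarrow> _"
  by standard (simp_all add: sfun_def fun_eq_iff algebra_simps)

definition lie_act ::
  "(complex^'n^'n) set \<Rightarrow> complex^'n^'n \<Rightarrow> (complex^'n^'n \<Rightarrow> complex) \<Rightarrow> complex^'n^'n \<Rightarrow> complex"
where
  "lie_act G X f = on_group G (\<lambda>g. deriv (\<lambda>t. f (g ** mexp (smat t X))) 0)"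

definition lie_submodule ::
  "(complex^'n^'n) set \<Rightarrow> (complex^'n^'n) set \<Rightarrow> (complex^'n^'n \<Rightarrow> complex) set \<Rightarrow> bool"
where
  "lie_submodule G L W \<longleftrightarrow> cfun.subspace W \<and> (\<forall>X\<in>L. \<forall>f\<in>W. lie_act G X f \<in> W)"

definition lie_irreducible ::
  "(complex^'n^'n) set \<Rightarrow> (complex^'n^'n) set \<Rightarrow> (complex^'n^'n \<Rightarrow> complex) set \<Rightarrow> bool"
where
  "lie_irreducible G L W \<longleftrightarrow> lie_submodule G L W \<and> W \<noteq> {0} \<and>
     (\<forall>U. lie_submodule G L U \<and> U \<subseteq> W \<longrightarrow> U = {0} \<or> U = W)"


section \<open>The determinants\<close>

text \<open>
  \<open>minor r s X\<close> is the minor on the columns \<open>X\<close> and the first \<open>length X\<close> of the rows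
  \<open>r, s\<close>; only lists of length 1 and 2 are used.
\<close>

fun minor :: "'n \<Rightarrow> 'n \<Rightarrow> 'n list \<Rightarrow> complex^'n^'n \<Rightarrow> complex" where
  "minor r s [i] g = g $ r $ i"
| "minor r s [i, j] g = g $ r $ i * g $ s $ j - g $ r $ j * g $ s $ i"
| "minor r s _ g = 0"

definition a3 :: "idx3 list \<Rightarrow> complex^idx3^idx3 \<Rightarrow> complex" where
  "a3 = minor N2' N1'"

definition a4 :: "idx4 list \<Rightarrow> complex^idx4^idx4 \<Rightarrow> complex" where
  "a4 = minor N2 N1"

definition S3 :: "idx3 list set" where
  "S3 = {[N2'], [N1'], [P1'], [N2', N1'], [N2', P1'], [N1', P1']}"

definition S4 :: "idx4 list set" where
  "S4 = {[N2], [N1], [P1], [P2], [N2, N1], [N2, P1], [P2, N1], [P2, P1], [N1, P1]}"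


section \<open>Gelfand-Tsetlin vectors for \<open>gl\<^sub>3\<close>\<close>

definition gl3_rep :: "nat \<Rightarrow> nat \<Rightarrow> (complex^idx3^idx3 \<Rightarrow> complex) set" where
  "gl3_rep m2 m1 = lie_submodule GL3 (gl UNIV) hull
     {on_group GL3 (\<lambda>g. a3 [N2'] g ^ (m2 - m1) * a3 [N2', N1'] g ^ m1)}"

definition gl2_component ::
  "nat \<Rightarrow> nat \<Rightarrow> nat \<Rightarrow> nat \<Rightarrow> (complex^idx3^idx3 \<Rightarrow> complex) set \<Rightarrow> bool"
where
  "gl2_component m2 m1 k2 k1 W \<longleftrightarrow>
     W \<subseteq> gl3_rep m2 m1 \<and> lie_irreducible GL3 (gl {N2', N1'}) W \<and>
     (\<exists>u\<in>W. u \<noteq> 0 \<and> lie_act GL3 (Emat N2' N1') u = 0 \<and>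
        lie_act GL3 (Emat N2' N2') u = sfun (of_nat k2) u \<and>
        lie_act GL3 (Emat N1' N1') u = sfun (of_nat k1) u)"

definition gt_vector ::
  "nat \<Rightarrow> nat \<Rightarrow> nat \<Rightarrow> nat \<Rightarrow> nat \<Rightarrow> (complex^idx3^idx3 \<Rightarrow> complex) \<Rightarrow> bool"
where
  "gt_vector m2 m1 k2 k1 h2 w \<longleftrightarrow>
     (\<exists>W. gl2_component m2 m1 k2 k1 W \<and> w \<in> W) \<and> w \<noteq> 0 \<and>
     lie_act GL3 (Emat N2' N2') w = sfun (of_nat h2) w"


section \<open>Gelfand-Tsetlin-Zhelobenko vectors for \<open>sp\<^sub>4\<close>\<close>

text \<open>
  Polynomials over \<open>\<complex>\<close> in variables of type \<open>'x\<close>: a monomial is a finitely supported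
  exponent function, a polynomial a finitely supported coefficient function on monomials.
\<close>

type_synonym 'x cpoly = "('x \<Rightarrow>\<^sub>0 nat) \<Rightarrow>\<^sub>0 complex"

definition poly_in :: "'x set \<Rightarrow> 'x cpoly \<Rightarrow> bool" where
  "poly_in V P \<longleftrightarrow> (\<forall>e \<in> Poly_Mapping.keys P. Poly_Mapping.keys e \<subseteq> V)"

definition poly_eval :: "'x cpoly \<Rightarrow> ('x \<Rightarrow> complex) \<Rightarrow> complex" where
  "poly_eval P v = (\<Sum>e \<in> Poly_Mapping.keys P. Poly_Mapping.lookup P e *
     (\<Prod>X \<in> Poly_Mapping.keys e. v X ^ Poly_Mapping.lookup e X))"

text \<open>
  The polynomial \<open>P\<close> representing the \<open>gl\<^sub>3\<close> vector is determined only modulo the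
  Pluecker relation; the predicate admits every choice of it.
\<close>

definition gtz_base_vector ::
  "nat \<Rightarrow> nat \<Rightarrow> nat \<Rightarrow> nat \<Rightarrow> nat \<Rightarrow> nat \<Rightarrow> (complex^idx4^idx4 \<Rightarrow> complex) \<Rightarrow> bool"
where
  "gtz_base_vector m2 m1 k2 k1 h2 h1 f \<longleftrightarrow>
     (\<exists>w P. gt_vector m2 m1 k2 k1 h2 w \<and> poly_in S3 P \<and>
        w = on_group GL3 (\<lambda>g. poly_eval P (\<lambda>X. a3 X g)) \<and>
        f = sfun (1 / fact (h2 - h1))
              ((lie_act Sp4 (Fmat P2 N2) ^^ (h2 - h1))
                (on_group Sp4 (\<lambda>g. poly_eval P (\<lambda>X. a4 (map incl X) g)))))"


section \<open>The Gamma-series\<close>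

definition gtz_lattice ::
  "nat \<Rightarrow> nat \<Rightarrow> nat \<Rightarrow> nat \<Rightarrow> nat \<Rightarrow> nat \<Rightarrow> (idx4 list \<Rightarrow> int) set"
where
  "gtz_lattice m2 m1 k2 k1 h2 h1 = {p \<in> S4 \<rightarrow>\<^sub>E UNIV.
     (\<Sum>X\<in>S4. p X) = int m2 \<and>
     (\<Sum>X\<in>{X\<in>S4. length X = 2}. p X) = int m1 \<and>
     (\<Sum>X\<in>{X\<in>S4. N2 \<in> set X \<or> P2 \<in> set X \<or> N1 \<in> set X}. p X) = int k2 \<and>
     p [N2, N1] + p [P2, N1] = int k1 \<and>
     (\<Sum>X\<in>{X\<in>S4. N2 \<in> set X \<or> P2 \<in> set X}. p X) = int h2 \<and>
     (\<Sum>X\<in>{X\<in>S4. N2 \<in> set X}. p X) = int h1}"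

text \<open>
  \<open>rGamma\<close> is the entire function \<open>1/\<Gamma>\<close>, which vanishes at the non-positive integers, so
  only finitely many terms of the series are nonzero.
\<close>

definition gtz_series ::
  "nat \<Rightarrow> nat \<Rightarrow> nat \<Rightarrow> nat \<Rightarrow> nat \<Rightarrow> nat \<Rightarrow> complex^idx4^idx4 \<Rightarrow> complex"
where
  "gtz_series m2 m1 k2 k1 h2 h1 = on_group Sp4 (\<lambda>g.
     \<Sum>\<^sub>\<infinity>p \<in> gtz_lattice m2 m1 k2 k1 h2 h1.
       \<Prod>X\<in>S4. a4 X g powi p X * rGamma (of_int (p X) + 1))"

end

theory Submission
  imports Defs
begin

text \<open>
  On \<open>GL\<^sub>3\<close> write \<open>x, y, z\<close> for \<open>a\<^bsub>-2\<^esub>, a\<^bsub>-1\<^esub>, a\<^bsub>1\<^esub>\<close> and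
  \<open>A, B, C\<close> for \<open>a\<^bsub>-2,-1\<^esub>, a\<^bsub>-2,1\<^esub>, a\<^bsub>-1,1\<^esub>\<close>. A \<open>gl\<^sub>2\<close>-highest vector of the
  \<open>gl\<^sub>3\<close>-representation is equivariant under lower triangular matrices from the left, killed by
  \<open>E\<^bsub>-2,-1\<^esub>\<close> and homogeneous under the torus from the right. These conditions determine it on a
  dense set up to a scalar, so it is the monomial in \<open>x, z, A, B\<close> of the given weight. The
  operator \<open>E\<^bsub>-1,-2\<^esub>\<close> is a derivation with \<open>x \<mapsto> y \<mapsto> 0\<close> and \<open>B \<mapsto> C \<mapsto> 0\<close> which kills \<open>z\<close> and \<open>A\<close>,
  and on \<open>Sp\<^sub>4\<close> the operator \<open>F\<^bsub>2,-2\<^esub>\<close> is twice a derivation of the same kind. The divided powers of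
  such a derivation, applied to a product of divided powers of determinants, are convolutions of
  sequences \<open>x\<^bsup>e-i\<^esup>/(e-i)! \<cdot> y\<^bsup>i\<^esup>/i!\<close>, and expanding them gives the Gamma-series.
\<close>

section \<open>The derivative of the matrix exponential at the origin\<close>

text \<open>Since \<open>gl3_rep\<close> is an intersection of submodules, it must be bounded from
  both sides: the left-equivariant polynomials form a submodule that contains it, and explicit
  lowering operators show that every submodule containing \<open>v_0\<close> contains the
  \<open>gl2\<close>-highest monomial. Uniqueness of that vector is a comparison: two highest
  vectors of equal weight are propagated from one base matrix by the same factor. The second
  obstacle is that the polynomial of step 2 is determined only modulo the Pluecker relation. An
  equality on \<open>GL3\<close> extends by density to all 3 x 3 matrices, singular ones included,
  and can then be read on a submatrix of a 4 x 4 matrix, so every choice gives the same function on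
  \<open>Sp4\<close>. The exponential enters only through its derivative at 0, and the flows that
  are integrated later are explicit curves. The final scalar carries \<open>2 ^ (h2 - h1)\<close>
  because \<open>Fmat P2 N2\<close> is twice a matrix unit.\<close>

lemma smat_nth [simp]: "smat c A $ i $ j = c * A $ i $ j"
  by (simp add: smat_def)

lemma smat_mult: "smat a X ** smat b Y = smat (a * b) (X ** Y)"
  by (simp add: vec_eq_iff matrix_matrix_mult_def sum_distrib_left mult_ac)

lemma mpow_smat: "((**) (smat t X) ^^ n) (mat 1) = smat (t ^ n) (((**) X ^^ n) (mat 1))"
proof (induction n)
  case 0
  then show ?case by (simp add: vec_eq_iff)
next
  case (Suc n)
  then show ?case by (simp add: smat_mult)
qed

text \<open>The sum over all entries dominates every row sum, so one factor of it absorbs each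
  multiplication by \<open>X\<close>. This majorizes the exponential series entrywise.\<close>

lemma norm_mpow_nth_le:
  fixes X :: "complex^'n^'n"
  shows "norm (((**) X ^^ n) (mat 1) $ i $ j) \<le> (\<Sum>a\<in>UNIV. \<Sum>b\<in>UNIV. norm (X $ a $ b)) ^ n"
proof (induction n arbitrary: i)
  case 0
  then show ?case by (simp add: mat_def)
next
  case (Suc n)
  let ?K = "\<Sum>a\<in>UNIV. \<Sum>b\<in>UNIV. norm (X $ a $ b)"
  have "norm (((**) X ^^ Suc n) (mat 1) $ i $ j)
      \<le> (\<Sum>k\<in>UNIV. norm (X $ i $ k) * norm (((**) X ^^ n) (mat 1) $ k $ j))"
    by (simp add: matrix_matrix_mult_def norm_mult[symmetric] norm_sum)
  also have "\<dots> \<le> (\<Sum>k\<in>UNIV. norm (X $ i $ k) * ?K ^ n)"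
    by (intro sum_mono mult_left_mono Suc.IH) auto
  also have "\<dots> = (\<Sum>k\<in>UNIV. norm (X $ i $ k)) * ?K ^ n"
    by (simp add: sum_distrib_right)
  also have "\<dots> \<le> ?K * ?K ^ n"
    by (intro mult_right_mono member_le_sum zero_le_power) (auto intro!: sum_nonneg)
  finally show ?case by simp
qed

lemma mexp_smat_nth:
  "mexp (smat t X) $ i $ j = suminf (\<lambda>n. (((**) X ^^ n) (mat 1) $ i $ j / fact n) * t ^ n)"
  by (simp add: mexp_def mpow_smat mult_ac)

lemma mexp_0 [simp]: "mexp 0 = mat 1"
proof -
  \<comment> \<open>Written as \<open>smat 0 X\<close>, the zero matrix is the point
    \<open>t = 0\<close> of a power series, where only the constant term survives.\<close>
  have "mexp (smat 0 X) = mat 1" for X :: "complex^'n^'n"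
    by (simp only: vec_eq_iff mexp_smat_nth powser_zero) simp
  then show ?thesis by simp
qed

lemma DERIV_mexp_0:
  "((\<lambda>t. mexp (smat t X) $ i $ j) has_field_derivative X $ i $ j) (at 0)"
proof -
  define c where "c n = ((**) X ^^ n) (mat 1) $ i $ j / fact n" for n
  let ?K = "\<Sum>a\<in>UNIV. \<Sum>b\<in>UNIV. norm (X $ a $ b)"
  \<comment> \<open>Convergence at 1 puts 0 strictly inside the disc of convergence, where the
    series may be differentiated termwise.\<close>
  have "summable (\<lambda>n. c n * 1 ^ n)"
  proof (rule summable_comparison_test')
    show "summable (\<lambda>n. ?K ^ n / fact n)"
      using summable_exp[of ?K] by (simp add: field_simps)
    show "norm (c n * 1 ^ n) \<le> ?K ^ n / fact n" if "n \<ge> 0" for n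
      using norm_mpow_nth_le[of n X i j] by (simp add: c_def norm_divide divide_right_mono)
  qed
  from termdiffs_strong[OF this, of 0]
  have "((\<lambda>t. suminf (\<lambda>n. c n * t ^ n)) has_field_derivative suminf (\<lambda>n. diffs c n * 0 ^ n)) (at 0)"
    by simp
  moreover have "suminf (\<lambda>n. diffs c n * 0 ^ n) = X $ i $ j"
    by (simp only: powser_zero) (simp add: diffs_def c_def)
  ultimately show ?thesis
    by (simp add: mexp_smat_nth c_def)
qed


section \<open>Polynomial functions on matrices\<close>

text \<open>These are functions on all matrices, not only on the group, so that they can be
  evaluated at singular ones. The four generators turn the chain rule into an induction.\<close>

inductive polyfun :: "(complex^'n^'n \<Rightarrow> complex) \<Rightarrow> bool" where
  polyfun_const: "polyfun (\<lambda>g. c)"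
| polyfun_entry: "polyfun (\<lambda>g. g $ i $ j)"
| polyfun_add: "polyfun f \<Longrightarrow> polyfun h \<Longrightarrow> polyfun (\<lambda>g. f g + h g)"
| polyfun_mult: "polyfun f \<Longrightarrow> polyfun h \<Longrightarrow> polyfun (\<lambda>g. f g * h g)"

named_theorems polyfun_intros
declare polyfun.intros [polyfun_intros]

lemma polyfun_sum [polyfun_intros]:
  "(\<And>i. i \<in> I \<Longrightarrow> polyfun (f i)) \<Longrightarrow> polyfun (\<lambda>g. \<Sum>i\<in>I. f i g)"
  by (induction I rule: infinite_finite_induct) (auto intro: polyfun_intros)

lemma polyfun_prod [polyfun_intros]:
  "(\<And>i. i \<in> I \<Longrightarrow> polyfun (f i)) \<Longrightarrow> polyfun (\<lambda>g. \<Prod>i\<in>I. f i g)"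
  by (induction I rule: infinite_finite_induct) (auto intro: polyfun_intros)

lemma polyfun_power [polyfun_intros]: "polyfun f \<Longrightarrow> polyfun (\<lambda>g. f g ^ n)"
  by (induction n) (auto intro: polyfun_intros)

lemma polyfun_diff [polyfun_intros]:
  assumes "polyfun f" "polyfun h"
  shows "polyfun (\<lambda>g. f g - h g)"
  using polyfun_add[OF assms(1) polyfun_mult[OF polyfun_const[of "-1"] assms(2)]] by simp

lemma polyfun_det: "polyfun (det :: complex^'n^'n \<Rightarrow> complex)"
  unfolding det_def by (intro polyfun_intros)

lemma polyfun_mult_entry [polyfun_intros]: "polyfun (\<lambda>g. (g ** X) $ i $ j)"
  by (simp add: matrix_matrix_mult_def) (intro polyfun_intros)

definition curve_deriv ::
  "(complex \<Rightarrow> complex^'n^'n) \<Rightarrow> complex^'n^'n \<Rightarrow> complex \<Rightarrow> bool"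
where
  "curve_deriv \<gamma> h t \<longleftrightarrow> (\<forall>i j. ((\<lambda>s. \<gamma> s $ i $ j) has_field_derivative h $ i $ j) (at t))"

text \<open>\<open>D g h\<close> is the differential at \<open>g\<close> in direction
  \<open>h\<close>. Its linearity in \<open>h\<close> makes the Lie algebra act linearly; the
  polynomiality clause keeps the derivatives along left-invariant fields inside
  \<open>polyfun\<close>.\<close>

definition total_deriv ::
  "(complex^'n^'n \<Rightarrow> complex) \<Rightarrow> (complex^'n^'n \<Rightarrow> complex^'n^'n \<Rightarrow> complex) \<Rightarrow> bool"
where
  "total_deriv \<phi> D \<longleftrightarrow>
     (\<forall>\<gamma> h t. curve_deriv \<gamma> h t \<longrightarrow>
        ((\<lambda>s. \<phi> (\<gamma> s)) has_field_derivative D (\<gamma> t) h) (at t)) \<and>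
     (\<forall>X. polyfun (\<lambda>g. D g (g ** X))) \<and>
     (\<forall>g h k. D g (h + k) = D g h + D g k) \<and>
     (\<forall>g c h. D g (smat c h) = c * D g h)"

lemma total_deriv_add:
  assumes "total_deriv f D" "total_deriv f' D'"
  shows "total_deriv (\<lambda>g. f g + f' g) (\<lambda>g h. D g h + D' g h)"
proof -
  have "polyfun (\<lambda>g. D g (g ** X) + D' g (g ** X))" for X
    using assms unfolding total_deriv_def by (intro polyfun_add) blast+
  then show ?thesis
    using assms unfolding total_deriv_def by (auto simp: algebra_simps intro!: DERIV_add)
qed

lemma total_deriv_mult:
  assumes "total_deriv f D" "total_deriv f' D'" "polyfun f" "polyfun f'"
  shows "total_deriv (\<lambda>g. f g * f' g) (\<lambda>g h. D g h * f' g + D' g h * f g)"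
proof -
  have "polyfun (\<lambda>g. D g (g ** X) * f' g + D' g (g ** X) * f g)" for X
    using assms unfolding total_deriv_def by (intro polyfun_add polyfun_mult) blast+
  moreover have "((\<lambda>s. f (\<gamma> s) * f' (\<gamma> s)) has_field_derivative
      D (\<gamma> t) h * f' (\<gamma> t) + D' (\<gamma> t) h * f (\<gamma> t)) (at t)" if "curve_deriv \<gamma> h t" for \<gamma> h t
    using assms that unfolding total_deriv_def by (intro DERIV_mult) blast+
  ultimately show ?thesis
    using assms unfolding total_deriv_def by (simp add: algebra_simps)
qed

lemma polyfun_total_deriv: "polyfun \<phi> \<Longrightarrow> \<exists>D. total_deriv \<phi> D"
proof (induction rule: polyfun.induct)
  case (polyfun_const c)
  have "total_deriv (\<lambda>g. c) (\<lambda>g h. 0)"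
    by (simp add: total_deriv_def polyfun.polyfun_const)
  then show ?case by blast
next
  case (polyfun_entry i j)
  have "total_deriv (\<lambda>g. g $ i $ j) (\<lambda>g h. h $ i $ j)"
    by (simp add: total_deriv_def curve_deriv_def polyfun_mult_entry)
  then show ?case by blast
next
  case (polyfun_add f h)
  then show ?case using total_deriv_add by blast
next
  case (polyfun_mult f h)
  then show ?case using total_deriv_mult by blast
qed

section \<open>Infinitesimal right shifts of polynomial functions\<close>

definition ldiff :: "complex^'n^'n \<Rightarrow> (complex^'n^'n \<Rightarrow> complex) \<Rightarrow> complex^'n^'n \<Rightarrow> complex" where
  "ldiff X \<phi> g = deriv (\<lambda>t. \<phi> (g ** mexp (smat t X))) 0"

text \<open>Polynomiality travels with the value of the derivative, so that the sum, product and
  power rules compose; \<open>lder_cong\<close> then brings the value into the desired form.\<close>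

definition lder ::
  "complex^'n^'n \<Rightarrow> (complex^'n^'n \<Rightarrow> complex) \<Rightarrow> (complex^'n^'n \<Rightarrow> complex) \<Rightarrow> bool"
where
  "lder X \<phi> \<psi> \<longleftrightarrow> polyfun \<phi> \<and> ldiff X \<phi> = \<psi>"

lemma curve_deriv_mexp: "curve_deriv (\<lambda>t. g ** mexp (smat t X)) (g ** X) 0"
  unfolding curve_deriv_def
  by (auto simp: matrix_matrix_mult_def intro!: DERIV_sum DERIV_cmult DERIV_mexp_0)

lemma total_deriv_ldiff:
  assumes "total_deriv \<phi> D"
  shows "ldiff X \<phi> = (\<lambda>g. D g (g ** X))"
proof
  fix g
  have "((\<lambda>t. \<phi> (g ** mexp (smat t X))) has_field_derivative
      D (g ** mexp (smat 0 X)) (g ** X)) (at 0)"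
    using assms curve_deriv_mexp[of g X] unfolding total_deriv_def by blast
  then show "ldiff X \<phi> g = D g (g ** X)"
    by (simp add: ldiff_def DERIV_imp_deriv)
qed

text \<open>\<open>\<gamma> t ** X\<close> is the value at \<open>\<gamma> t\<close> of the
  left-invariant vector field of \<open>X\<close>, so this is the chain rule for integral curves, at
  any time \<open>t\<close> and not only for the exponential curve at 0.\<close>

lemma DERIV_curve:
  assumes "polyfun \<phi>" "curve_deriv \<gamma> (\<gamma> t ** X) t"
  shows "((\<lambda>s. \<phi> (\<gamma> s)) has_field_derivative ldiff X \<phi> (\<gamma> t)) (at t)"
proof -
  obtain D where D: "total_deriv \<phi> D" using polyfun_total_deriv[OF assms(1)] ..
  then show ?thesis
    using assms(2) by (simp add: total_deriv_ldiff total_deriv_def)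
qed

lemma polyfun_isCont_curve:
  assumes "polyfun \<phi>" "curve_deriv \<gamma> h t"
  shows "isCont (\<lambda>s. \<phi> (\<gamma> s)) t"
proof -
  obtain D where "total_deriv \<phi> D" using polyfun_total_deriv[OF assms(1)] ..
  then show ?thesis
    using assms(2) unfolding total_deriv_def by (blast intro: DERIV_isCont)
qed

lemma DERIV_ldiff:
  assumes "polyfun \<phi>"
  shows "((\<lambda>t. \<phi> (g ** mexp (smat t X))) has_field_derivative ldiff X \<phi> g) (at 0)"
  using DERIV_curve[OF assms, of "\<lambda>t. g ** mexp (smat t X)" 0 X] curve_deriv_mexp[of g X] by simp

lemma polyfun_ldiff:
  assumes "polyfun \<phi>"
  shows "polyfun (ldiff X \<phi>)"
proof -
  obtain D where "total_deriv \<phi> D" using polyfun_total_deriv[OF assms(1)] ..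
  then show ?thesis
    by (simp add: total_deriv_ldiff) (simp add: total_deriv_def)
qed

lemma lder_ldiff: "polyfun \<phi> \<Longrightarrow> lder X \<phi> (ldiff X \<phi>)"
  by (simp add: lder_def)

lemma lder_add_left:
  assumes "lder X \<phi> \<psi>" "lder Y \<phi> \<psi>'"
  shows "lder (X + Y) \<phi> (\<lambda>g. \<psi> g + \<psi>' g)"
proof -
  have \<phi>: "polyfun \<phi>" "ldiff X \<phi> = \<psi>" "ldiff Y \<phi> = \<psi>'"
    using assms by (auto simp: lder_def)
  obtain D where D: "total_deriv \<phi> D" using polyfun_total_deriv[OF \<phi>(1)] ..
  then have "D g (h + k) = D g h + D g k" for g h k
    by (simp add: total_deriv_def)
  then show ?thesis
    using \<phi> D by (auto simp: lder_def total_deriv_ldiff matrix_add_ldistrib)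
qed

lemma lder_smat_left:
  assumes "lder X \<phi> \<psi>"
  shows "lder (smat c X) \<phi> (\<lambda>g. c * \<psi> g)"
proof -
  have \<phi>: "polyfun \<phi>" "ldiff X \<phi> = \<psi>"
    using assms by (auto simp: lder_def)
  obtain D where D: "total_deriv \<phi> D" using polyfun_total_deriv[OF \<phi>(1)] ..
  then have "D g (smat c h) = c * D g h" for g c h
    by (simp add: total_deriv_def)
  moreover have "g ** smat c X = smat c (g ** X)" for g
    by (simp add: vec_eq_iff matrix_matrix_mult_def sum_distrib_left mult_ac)
  ultimately show ?thesis
    using \<phi> D by (auto simp: lder_def total_deriv_ldiff)
qed

lemma lder_DERIV:
  assumes "polyfun \<phi>"
    and "\<And>g. ((\<lambda>t. \<phi> (g ** mexp (smat t X))) has_field_derivative \<psi> g) (at 0)"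
  shows "lder X \<phi> \<psi>"
  using assms DERIV_imp_deriv[OF assms(2)] by (simp add: lder_def ldiff_def fun_eq_iff)

lemma lder_imp_DERIV:
  "lder X \<phi> \<psi> \<Longrightarrow> ((\<lambda>t. \<phi> (g ** mexp (smat t X))) has_field_derivative \<psi> g) (at 0)"
  using DERIV_ldiff by (auto simp: lder_def)

lemma lder_polyfun: "lder X \<phi> \<psi> \<Longrightarrow> polyfun \<phi>"
  by (simp add: lder_def)

lemma lder_cong: "lder X \<phi> \<psi> \<Longrightarrow> (\<And>g. \<psi> g = \<psi>' g) \<Longrightarrow> lder X \<phi> \<psi>'"
  by (simp add: lder_def fun_eq_iff)

lemma lder_const: "lder X (\<lambda>g. c) (\<lambda>g. 0)"
  by (rule lder_DERIV) (simp_all add: polyfun_const)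

lemma lder_entry: "lder X (\<lambda>g. g $ i $ j) (\<lambda>g. (g ** X) $ i $ j)"
proof (rule lder_DERIV)
  show "((\<lambda>t. (g ** mexp (smat t X)) $ i $ j) has_field_derivative (g ** X) $ i $ j) (at 0)" for g
    using curve_deriv_mexp[of g X] unfolding curve_deriv_def by blast
qed (rule polyfun_entry)

lemma lder_add:
  assumes "lder X f f'" "lder X h h'"
  shows "lder X (\<lambda>g. f g + h g) (\<lambda>g. f' g + h' g)"
proof (rule lder_DERIV)
  show "polyfun (\<lambda>g. f g + h g)"
    using assms by (intro polyfun_add) (auto intro: lder_polyfun)
qed (rule DERIV_add[OF lder_imp_DERIV[OF assms(1)] lder_imp_DERIV[OF assms(2)]])

lemma lder_diff:
  assumes "lder X f f'" "lder X h h'"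
  shows "lder X (\<lambda>g. f g - h g) (\<lambda>g. f' g - h' g)"
proof (rule lder_DERIV)
  show "polyfun (\<lambda>g. f g - h g)"
    using assms by (intro polyfun_diff) (auto intro: lder_polyfun)
qed (rule DERIV_diff[OF lder_imp_DERIV[OF assms(1)] lder_imp_DERIV[OF assms(2)]])

lemma lder_mult:
  assumes "lder X f f'" "lder X h h'"
  shows "lder X (\<lambda>g. f g * h g) (\<lambda>g. f' g * h g + f g * h' g)"
proof (rule lder_DERIV)
  show "polyfun (\<lambda>g. f g * h g)"
    using assms by (intro polyfun_mult) (auto intro: lder_polyfun)
  show "((\<lambda>t. f (g ** mexp (smat t X)) * h (g ** mexp (smat t X))) has_field_derivative
      f' g * h g + f g * h' g) (at 0)" for g
    using DERIV_mult[OF lder_imp_DERIV[OF assms(1)] lder_imp_DERIV[OF assms(2)], of g]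
    by (simp add: mult_ac)
qed

lemma lder_power:
  assumes "lder X f f'"
  shows "lder X (\<lambda>g. f g ^ n) (\<lambda>g. of_nat n * f g ^ (n - 1) * f' g)"
proof (rule lder_DERIV)
  show "polyfun (\<lambda>g. f g ^ n)"
    using assms by (intro polyfun_power) (auto intro: lder_polyfun)
  show "((\<lambda>t. f (g ** mexp (smat t X)) ^ n) has_field_derivative
      of_nat n * f g ^ (n - 1) * f' g) (at 0)" for g
    using DERIV_power[OF lder_imp_DERIV[OF assms(1), of g], of n]
    by (simp add: mult_ac)
qed

lemma lder_sum:
  assumes "\<And>i. i \<in> I \<Longrightarrow> lder X (f i) (f' i)"
  shows "lder X (\<lambda>g. \<Sum>i\<in>I. f i g) (\<lambda>g. \<Sum>i\<in>I. f' i g)"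
proof (rule lder_DERIV)
  show "polyfun (\<lambda>g. \<Sum>i\<in>I. f i g)"
    using assms by (intro polyfun_sum) (auto intro: lder_polyfun)
qed (intro DERIV_sum lder_imp_DERIV assms)

lemma lder_cmult: "lder X f f' \<Longrightarrow> lder X (\<lambda>g. c * f g) (\<lambda>g. c * f' g)"
  using lder_mult[OF lder_const[of X c]] by simp

lemma lder_cdivide: "lder X f f' \<Longrightarrow> lder X (\<lambda>g. f g / c) (\<lambda>g. f' g / c)"
  using lder_cmult[of X f f' "1 / c"] by simp


section \<open>The Lie algebra action on polynomial functions\<close>

text \<open>The cut-off outside \<open>G\<close> does not disturb the derivative as long as the
  curve stays in \<open>G\<close> near 0. For \<open>Sp4\<close> this holds at all \<open>t\<close>
  by construction, for \<open>GL3\<close> because it is open.\<close>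

lemma lie_act_on_group:
  assumes "lder X \<phi> \<psi>"
    and "\<And>g. g \<in> G \<Longrightarrow> \<forall>\<^sub>F t in nhds 0. g ** mexp (smat t X) \<in> G"
  shows "lie_act G X (on_group G \<phi>) = on_group G \<psi>"
proof -
  have "deriv (\<lambda>t. on_group G \<phi> (g ** mexp (smat t X))) 0 = \<psi> g" if "g \<in> G" for g
  proof -
    have "deriv (\<lambda>t. on_group G \<phi> (g ** mexp (smat t X))) 0 =
        deriv (\<lambda>t. \<phi> (g ** mexp (smat t X))) 0"
      by (rule deriv_cong_ev)
        (use assms(2)[OF that] in \<open>auto simp: on_group_def elim!: eventually_mono\<close>)
    also have "\<dots> = \<psi> g"
      by (rule DERIV_imp_deriv) (rule lder_imp_DERIV[OF assms(1)])
    finally show ?thesis .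
  qed
  then show ?thesis
    by (auto simp: lie_act_def on_group_def fun_eq_iff)
qed

lemma lie_act_Sp4:
  assumes "lder X \<phi> \<psi>" "X \<in> sp4"
  shows "lie_act Sp4 X (on_group Sp4 \<phi>) = on_group Sp4 \<psi>"
proof (rule lie_act_on_group[OF assms(1)])
  fix g assume "g \<in> Sp4"
  then show "\<forall>\<^sub>F t in nhds 0. g ** mexp (smat t X) \<in> Sp4"
    using assms(2) by (auto simp: sp4_def intro!: always_eventually Sp4.mult_exp cmat.span_scale)
qed

lemma lie_act_GL3:
  assumes "lder X \<phi> \<psi>"
  shows "lie_act GL3 X (on_group GL3 \<phi>) = on_group GL3 \<psi>"
proof (rule lie_act_on_group[OF assms(1)])
  fix g :: "complex^idx3^idx3"
  assume g: "g \<in> GL3"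
  let ?d = "\<lambda>t. det (g ** mexp (smat t X))"
  have "isCont ?d 0"
    by (rule DERIV_isCont[OF DERIV_ldiff[OF polyfun_det]])
  then have "(?d \<longlongrightarrow> ?d 0) (nhds 0)"
    using tendsto_at_iff_tendsto_nhds[of ?d 0] by (simp add: isCont_def)
  moreover have "?d 0 \<noteq> 0"
    using g by (simp add: GL3_def invertible_det_nz)
  ultimately have "\<forall>\<^sub>F t in nhds 0. ?d t \<noteq> 0"
    by (rule tendsto_imp_eventually_ne)
  then show "\<forall>\<^sub>F t in nhds 0. g ** mexp (smat t X) \<in> GL3"
    by (auto simp: GL3_def invertible_det_nz elim: eventually_mono)
qed


section \<open>Sequences of divided powers\<close>

text \<open>For a derivation \<open>N\<close> with \<open>x \<mapsto> y \<mapsto> 0\<close> this is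
  \<open>N^i / i!\<close> applied to \<open>x^a / a!\<close>. The value 0 for \<open>i > a\<close>
  is the true one and guards against the truncated \<open>a - i\<close>.\<close>

definition dpow :: "nat \<Rightarrow> nat \<Rightarrow> complex \<Rightarrow> complex \<Rightarrow> complex" where
  "dpow a i x y = (if i \<le> a then x ^ (a - i) / fact (a - i) * (y ^ i / fact i) else 0)"

text \<open>Leibniz rule for divided powers: if \<open>f i\<close> and \<open>h i\<close> come from
  \<open>N^i / i!\<close> applied to two functions, this is \<open>N^n / n!\<close> applied to their
  product.\<close>

definition conv ::
  "(nat \<Rightarrow> 'g \<Rightarrow> complex) \<Rightarrow> (nat \<Rightarrow> 'g \<Rightarrow> complex) \<Rightarrow> nat \<Rightarrow> 'g \<Rightarrow> complex"
where
  "conv f h n g = (\<Sum>i\<le>n. f i g * h (n - i) g)"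

lemma Suc_times_divided_power:
  fixes u v :: complex
  shows "of_nat (Suc n) * u / (of_nat (Suc n) * v) = u / v"
  by (rule mult_divide_mult_cancel_left) (simp only: of_nat_neq_0 not_False_eq_True)

lemma one_plus_of_nat_neq_0: "1 + of_nat n \<noteq> (0 :: complex)"
  using of_nat_neq_0[of n, where ?'a = complex] by simp

lemma fact_Suc_complex: "fact (Suc n) = (of_nat (Suc n) * fact n :: complex)"
  by simp

lemma lder_divided_power:
  assumes "lder X x x'"
  shows "lder X (\<lambda>g. x g ^ n / fact n)
    (\<lambda>g. if n = 0 then 0 else x g ^ (n - 1) / fact (n - 1) * x' g)"
proof (rule lder_cong[OF lder_cdivide[OF lder_power[OF assms]]])
  show "of_nat n * x g ^ (n - 1) * x' g / fact n =
      (if n = 0 then 0 else x g ^ (n - 1) / fact (n - 1) * x' g)" for g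
  proof (cases n)
    case (Suc m)
    show ?thesis
      unfolding Suc fact_Suc_complex mult.assoc Suc_times_divided_power by simp
  qed simp
qed

lemma lder_dpow:
  assumes "lder X x x'" "lder X y y'"
  shows "lder X (\<lambda>g. dpow a i (x g) (y g)) (\<lambda>g. if i \<le> a then
      (if i = a then 0 else x g ^ (a - i - 1) / fact (a - i - 1) * x' g) * (y g ^ i / fact i) +
      x g ^ (a - i) / fact (a - i) * (if i = 0 then 0 else y g ^ (i - 1) / fact (i - 1) * y' g)
    else 0)"
proof (cases "i \<le> a")
  case True
  have "lder X (\<lambda>g. x g ^ (a - i) / fact (a - i) * (y g ^ i / fact i))
    (\<lambda>g. (if a - i = 0 then 0 else x g ^ (a - i - 1) / fact (a - i - 1) * x' g) * (y g ^ i / fact i) +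
      x g ^ (a - i) / fact (a - i) * (if i = 0 then 0 else y g ^ (i - 1) / fact (i - 1) * y' g))"
    by (intro lder_mult lder_divided_power assms)
  then show ?thesis using True by (auto simp: dpow_def elim!: lder_cong)
next
  case False
  then show ?thesis by (simp add: dpow_def lder_const)
qed

lemma lder_dpow_lower:
  assumes "lder X x (\<lambda>g. r * y g)" "lder X y (\<lambda>g. 0)"
  shows "lder X (\<lambda>g. dpow a i (x g) (y g)) (\<lambda>g. r * of_nat (Suc i) * dpow a (Suc i) (x g) (y g))"
proof (rule lder_cong[OF lder_dpow[OF assms]], goal_cases)
  case (1 g)
  have "fact (Suc i) = (of_nat (Suc i) * fact i :: complex)" by simp
  moreover have "(of_nat (Suc i) :: complex) \<noteq> 0" by (simp only: of_nat_neq_0 not_False_eq_True)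
  ultimately show ?case
    by (auto simp: dpow_def field_simps simp del: of_nat_Suc fact_Suc)
qed

text \<open>The \<open>sl2\<close> relation \<open>E F^i/i! v = (a + 1 - i) F^(i-1)/(i-1)! v\<close>
  for the highest vector \<open>v = x^a / a!\<close> of weight \<open>a\<close>.\<close>

lemma lder_dpow_raise:
  assumes "lder X x (\<lambda>g. 0)" "lder X y x"
  shows "lder X (\<lambda>g. dpow a i (x g) (y g))
    (\<lambda>g. if i = 0 then 0 else (of_nat a + 1 - of_nat i) * dpow a (i - 1) (x g) (y g))"
proof (rule lder_cong[OF lder_dpow[OF assms]], goal_cases)
  case (1 g)
  show ?case
  proof (cases "i \<noteq> 0 \<and> i \<le> a")
    case True
    then obtain d j where d: "a = i + d" "i = Suc j"
      by (metis le_Suc_ex not0_implies_Suc)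
    then have eqs: "a - i = d" "a - (i - 1) = Suc d" "i - 1 = j" "i \<le> a" "i - 1 \<le> a" "i \<noteq> 0"
      by auto
    have *: "of_nat a + 1 - of_nat i = (of_nat (Suc d) :: complex)" by (simp add: d)
    have "of_nat (Suc d) * (x g ^ Suc d / fact (Suc d)) = x g ^ d / fact d * x g"
      unfolding fact_Suc_complex times_divide_eq_right Suc_times_divided_power by simp
    note E = this
    have "x g ^ d / fact d * (y g ^ j / fact j * x g) =
        x g ^ d / fact d * x g * (y g ^ j / fact j)"
      by (simp only: mult_ac)
    also have "\<dots> = of_nat (Suc d) * (x g ^ Suc d / fact (Suc d) * (y g ^ j / fact j))"
      unfolding E[symmetric] mult.assoc ..
    finally have "x g ^ d / fact d * (y g ^ j / fact j * x g) =
        of_nat (Suc d) * (x g ^ Suc d / fact (Suc d) * (y g ^ j / fact j))" .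
    then show ?thesis
      unfolding * dpow_def eqs using eqs d(2) by (simp del: of_nat_Suc fact_Suc power_Suc)
  next
    case False
    \<comment> \<open>At \<open>i = a + 1\<close> the left side is 0 while \<open>dpow a a\<close>
      need not be; there the coefficient \<open>a + 1 - i\<close> vanishes.\<close>
    then show ?thesis by (cases "i = Suc a") (auto simp: dpow_def)
  qed
qed

lemma lder_dpow_weight:
  assumes "lder X x (\<lambda>g. r * x g)" "lder X y (\<lambda>g. s * y g)"
  shows "lder X (\<lambda>g. dpow a i (x g) (y g))
    (\<lambda>g. (r * (of_nat a - of_nat i) + s * of_nat i) * dpow a i (x g) (y g))"
proof (rule lder_cong[OF lder_dpow[OF assms]], goal_cases)
  case (1 g)
  have *: "(if n = 0 then 0 else u ^ (n - 1) / fact (n - 1) * (t * u)) = t * of_nat n * (u ^ n / fact n)"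
    for n and u t :: complex
  proof (cases n)
    case (Suc m)
    show ?thesis
      unfolding Suc fact_Suc_complex mult.assoc times_divide_eq_right Suc_times_divided_power
      by (simp add: mult_ac one_plus_of_nat_neq_0)
  qed simp
  show ?case
  proof (cases "i \<le> a")
    case True
    then have eqs: "(a - i = 0) = (i = a)" "(of_nat (a - i) :: complex) = of_nat a - of_nat i"
      by (auto simp: of_nat_diff)
    have "(if i = a then 0 else x g ^ (a - i - 1) / fact (a - i - 1) * (r * x g)) =
        r * (of_nat a - of_nat i) * (x g ^ (a - i) / fact (a - i))"
      using *[of "a - i" "x g" r] unfolding eqs .
    moreover have "(if i = 0 then 0 else y g ^ (i - 1) / fact (i - 1) * (s * y g)) =
        s * of_nat i * (y g ^ i / fact i)"
      by (rule *)
    ultimately show ?thesis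
      using True unfolding dpow_def by (simp only: if_True distrib_left distrib_right mult_ac)
  qed (simp add: dpow_def)
qed

lemma lder_conv:
  assumes "\<And>i. lder X (f i) (f' i)" "\<And>i. lder X (h i) (h' i)"
  shows "lder X (conv f h n) (\<lambda>g. \<Sum>i\<le>n. f' i g * h (n - i) g + f i g * h' (n - i) g)"
  unfolding conv_def by (intro lder_sum lder_mult assms)

text \<open>After an index shift the product of \<open>f i\<close> and \<open>h (Suc n - i)\<close>
  gets the coefficient \<open>i\<close> from the first factor and \<open>Suc n - i\<close> from the
  second, in total \<open>Suc n\<close>.\<close>

lemma lder_conv_lower:
  assumes "\<And>i. lder X (f i) (\<lambda>g. r * of_nat (Suc i) * f (Suc i) g)"
    and "\<And>i. lder X (h i) (\<lambda>g. r * of_nat (Suc i) * h (Suc i) g)"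
  shows "lder X (conv f h n) (\<lambda>g. r * of_nat (Suc n) * conv f h (Suc n) g)"
proof (rule lder_cong[OF lder_conv[OF assms]])
  fix g
  have "(\<Sum>i\<le>n. of_nat (Suc i) * f (Suc i) g * h (n - i) g) =
      (\<Sum>i\<le>Suc n. of_nat i * f i g * h (Suc n - i) g)"
    by (subst sum.atMost_Suc_shift) simp
  moreover have "(\<Sum>i\<le>n. f i g * (of_nat (Suc (n - i)) * h (Suc (n - i)) g)) =
      (\<Sum>i\<le>Suc n. of_nat (Suc n - i) * f i g * h (Suc n - i) g)"
    by (simp add: Suc_diff_le mult_ac del: of_nat_Suc of_nat_diff)
  moreover have "of_nat (Suc n) * conv f h (Suc n) g =
      (\<Sum>i\<le>Suc n. of_nat i * f i g * h (Suc n - i) g) +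
      (\<Sum>i\<le>Suc n. of_nat (Suc n - i) * f i g * h (Suc n - i) g)"
  proof -
    have "of_nat (Suc n) * (f i g * h (Suc n - i) g) =
        of_nat i * f i g * h (Suc n - i) g + of_nat (Suc n - i) * f i g * h (Suc n - i) g"
      if "i \<le> Suc n" for i
    proof -
      have "(of_nat (Suc n) :: complex) = of_nat i + of_nat (Suc n - i)"
        using that by (metis le_add_diff_inverse of_nat_add)
      then show ?thesis by (simp add: algebra_simps del: of_nat_Suc)
    qed
    then show ?thesis
      unfolding conv_def sum_distrib_left sum.distrib[symmetric] by (intro sum.cong) auto
  qed
  moreover have "(\<Sum>i\<le>n. r * of_nat (Suc i) * f (Suc i) g * h (n - i) g +
      f i g * (r * of_nat (Suc (n - i)) * h (Suc (n - i)) g)) =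
      r * ((\<Sum>i\<le>n. of_nat (Suc i) * f (Suc i) g * h (n - i) g) +
        (\<Sum>i\<le>n. f i g * (of_nat (Suc (n - i)) * h (Suc (n - i)) g)))"
    unfolding sum_distrib_left sum.distrib distrib_left by (simp only: mult_ac)
  ultimately show "(\<Sum>i\<le>n. r * of_nat (Suc i) * f (Suc i) g * h (n - i) g +
      f i g * (r * of_nat (Suc (n - i)) * h (Suc (n - i)) g)) =
      r * of_nat (Suc n) * conv f h (Suc n) g"
    by (simp only: mult.assoc)
qed

text \<open>The product of \<open>f i\<close> and \<open>h (n - 1 - i)\<close> gets
  \<open>a - i\<close> and \<open>b - (n - 1 - i)\<close>, whose sum is independent of
  \<open>i\<close>: highest weights add.\<close>

lemma lder_conv_raise:
  assumes f: "\<And>i. lder X (f i) (\<lambda>g. if i = 0 then 0 else (a + 1 - of_nat i) * f (i - 1) g)"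
    and h: "\<And>i. lder X (h i) (\<lambda>g. if i = 0 then 0 else (b + 1 - of_nat i) * h (i - 1) g)"
  shows "lder X (conv f h n)
    (\<lambda>g. if n = 0 then 0 else (a + b + 1 - of_nat n) * conv f h (n - 1) g)"
proof (rule lder_cong[OF lder_conv[OF f h]], goal_cases)
  case (1 g)
  show ?case
  proof (cases n)
    case (Suc m)
    have "(\<Sum>i\<le>Suc m. (if i = 0 then 0 else (a + 1 - of_nat i) * f (i - 1) g) * h (Suc m - i) g) =
        (\<Sum>i\<le>m. (a - of_nat i) * f i g * h (m - i) g)"
      by (subst sum.atMost_Suc_shift) simp
    moreover have "(\<Sum>i\<le>Suc m. f i g *
          (if Suc m - i = 0 then 0 else (b + 1 - of_nat (Suc m - i)) * h (Suc m - i - 1) g)) =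
        (\<Sum>i\<le>m. (b - of_nat (m - i)) * f i g * h (m - i) g)"
      by (auto simp: Suc_diff_le intro!: sum.cong)
    moreover have "(a + b - of_nat m) * conv f h m g =
        (\<Sum>i\<le>m. (a - of_nat i) * f i g * h (m - i) g) +
        (\<Sum>i\<le>m. (b - of_nat (m - i)) * f i g * h (m - i) g)"
      unfolding conv_def sum_distrib_left sum.distrib[symmetric]
      by (intro sum.cong) (auto simp: of_nat_diff algebra_simps)
    ultimately show ?thesis
      unfolding Suc sum.distrib by (simp add: algebra_simps del: sum.atMost_Suc)
  qed simp
qed

lemma lder_conv_weight:
  assumes f: "\<And>i. lder X (f i) (\<lambda>g. (a + s * of_nat i) * f i g)"
    and h: "\<And>i. lder X (h i) (\<lambda>g. (b + s * of_nat i) * h i g)"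
  shows "lder X (conv f h n) (\<lambda>g. (a + b + s * of_nat n) * conv f h n g)"
proof (rule lder_cong[OF lder_conv[OF f h]], goal_cases)
  case (1 g)
  show ?case
    unfolding conv_def sum_distrib_left
    by (intro sum.cong) (auto simp: of_nat_diff algebra_simps)
qed


section \<open>Minors under elementary matrices\<close>

lemma mult_Emat_nth: "(g ** Emat p q) $ r $ j = (if j = q then g $ r $ p else 0)"
proof -
  have "(g ** Emat p q) $ r $ j = (\<Sum>k\<in>UNIV. if k = p then (if j = q then g $ r $ k else 0) else 0)"
    unfolding matrix_matrix_mult_def Emat_def vec_lambda_beta by (intro sum.cong) auto
  then show ?thesis by simp
qed

text \<open>\<open>g ** Emat p q\<close> has column \<open>p\<close> of \<open>g\<close> in place
  \<open>q\<close> and zeros elsewhere, so the derivation replaces the index \<open>q\<close> by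
  \<open>p\<close>.\<close>

lemma lder_minor1:
  "lder (Emat p q) (minor r s [j]) (\<lambda>g. if j = q then minor r s [p] g else 0)"
proof -
  have "minor r s [i] = (\<lambda>g. g $ r $ i)" for i :: 'a
    by (simp add: fun_eq_iff)
  then show ?thesis
    using lder_entry[of "Emat p q" r j] by (simp add: mult_Emat_nth cong: if_cong)
qed

lemma lder_minor2:
  "lder (Emat p q) (minor r s [i, j])
    (\<lambda>g. (if i = q then minor r s [p, j] g else 0) + (if j = q then minor r s [i, p] g else 0))"
proof -
  have "lder (Emat p q) (\<lambda>g. g $ r $ i * g $ s $ j - g $ r $ j * g $ s $ i)
    (\<lambda>g. (g ** Emat p q) $ r $ i * g $ s $ j + g $ r $ i * (g ** Emat p q) $ s $ j
      - ((g ** Emat p q) $ r $ j * g $ s $ i + g $ r $ j * (g ** Emat p q) $ s $ i))"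
    by (intro lder_diff lder_mult lder_entry)
  moreover have "minor r s [i, j] = (\<lambda>g. g $ r $ i * g $ s $ j - g $ r $ j * g $ s $ i)" for i j :: 'a
    by (simp add: fun_eq_iff)
  ultimately show ?thesis
    by (auto simp: mult_Emat_nth algebra_simps elim!: lder_cong)
qed

lemma on_group_add: "on_group G (\<lambda>g. f g + h g) = on_group G f + on_group G h"
  by (auto simp: on_group_def)

lemma on_group_cmult: "on_group G (\<lambda>g. c * f g) = sfun c (on_group G f)"
  by (auto simp: on_group_def sfun_def)

lemma on_group_0: "on_group G (\<lambda>g. 0) = 0"
  by (auto simp: on_group_def)

lemma on_group_sum_in_subspace:
  assumes "cfun.subspace W" "\<And>n. n \<in> I \<Longrightarrow> on_group G (f n) \<in> W"
  shows "on_group G (\<lambda>g. \<Sum>n\<in>I. d n * f n g) \<in> W"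
  using assms(2)
proof (induction I rule: infinite_finite_induct)
  case (insert n I)
  then have "sfun (d n) (on_group G (f n)) + on_group G (\<lambda>g. \<Sum>n\<in>I. d n * f n g) \<in> W"
    by (intro cfun.subspace_add cfun.subspace_scale assms(1)) auto
  also have "sfun (d n) (on_group G (f n)) + on_group G (\<lambda>g. \<Sum>n\<in>I. d n * f n g) =
      on_group G (\<lambda>g. \<Sum>n\<in>insert n I. d n * f n g)"
    unfolding on_group_cmult[symmetric] on_group_add[symmetric] using insert by simp
  finally show ?case .
qed (simp_all add: on_group_0 cfun.subspace_0 assms(1))


section \<open>Gelfand-Tsetlin functions\<close>

text \<open>
  The exponents are \<open>c = m2 - k2\<close>, \<open>p = k1\<close>, \<open>a = k2 - m1\<close>, \<open>b = m1 - k1\<close>, and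
  \<open>n = k2 - h2\<close> is the number of applications of \<^term>\<open>Emat N1' N2'\<close> to the \<open>gl\<^sub>2\<close>-highest
  vector.
\<close>

definition gt_val ::
  "nat \<Rightarrow> nat \<Rightarrow> nat \<Rightarrow> nat \<Rightarrow> nat \<Rightarrow> (idx3 list \<Rightarrow> complex) \<Rightarrow> complex"
where
  "gt_val c p a b n v = dpow (c + p) p (v [P1']) (v [N2', N1']) *
     (\<Sum>i\<le>n. dpow a i (v [N2']) (v [N1']) * dpow b (n - i) (v [N2', P1']) (v [N1', P1']))"

text \<open>Kept apart from \<open>gt_val\<close>, which takes arbitrary values of the determinants,
  so that the same polynomial can later be evaluated on \<open>Sp4\<close>.\<close>

definition gt_fun ::
  "nat \<Rightarrow> nat \<Rightarrow> nat \<Rightarrow> nat \<Rightarrow> nat \<Rightarrow> complex^idx3^idx3 \<Rightarrow> complex"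
where
  "gt_fun c p a b n g = gt_val c p a b n (\<lambda>X. a3 X g)"

text \<open>The factor \<open>dpow (c + p) p\<close> is merely \<open>z^c / c!\<close> times
  \<open>A^p / p!\<close>; in this form \<open>lder_dpow_weight\<close> treats both at once.\<close>

lemma gt_fun_conv:
  "gt_fun c p a b n = (\<lambda>g. dpow (c + p) p (a3 [P1'] g) (a3 [N2', N1'] g) *
     conv (\<lambda>i g. dpow a i (a3 [N2'] g) (a3 [N1'] g)) (\<lambda>i g. dpow b i (a3 [N2', P1'] g) (a3 [N1', P1'] g)) n g)"
  by (simp add: fun_eq_iff gt_fun_def gt_val_def conv_def)

lemma dpow_eq_0: "i > a \<Longrightarrow> dpow a i x y = 0"
  by (simp add: dpow_def)

lemma gt_val_eq_0:
  assumes "n > a + b"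
  shows "gt_val c p a b n v = 0"
proof -
  have *: "dpow a i x y * dpow b (n - i) u w = 0" for i x y u w
    using assms by (cases "i \<le> a") (simp_all add: dpow_eq_0)
  show ?thesis by (simp only: gt_val_def * sum.neutral_const mult_zero_right)
qed

lemma gt_fun_eq_0: "n > a + b \<Longrightarrow> gt_fun c p a b n g = 0"
  by (simp add: gt_fun_def gt_val_eq_0)

text \<open>The factors \<open>1 *\<close> and \<open>0 *\<close> are kept so that the equations
  match the premises of \<open>lder_dpow_lower\<close> and \<open>lder_dpow_weight\<close>.\<close>

lemma lder_a3_E21:
  "lder (Emat N1' N2') (a3 [N2']) (\<lambda>g. 1 * a3 [N1'] g)"
  "lder (Emat N1' N2') (a3 [N1']) (\<lambda>g. 0)"
  "lder (Emat N1' N2') (a3 [P1']) (\<lambda>g. 0 * a3 [P1'] g)"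
  "lder (Emat N1' N2') (a3 [N2', N1']) (\<lambda>g. 0 * a3 [N2', N1'] g)"
  "lder (Emat N1' N2') (a3 [N2', P1']) (\<lambda>g. 1 * a3 [N1', P1'] g)"
  "lder (Emat N1' N2') (a3 [N1', P1']) (\<lambda>g. 0)"
  unfolding a3_def
  by ((rule lder_cong[OF lder_minor1], simp; fail) | (rule lder_cong[OF lder_minor2], simp; fail))+

lemma lder_a3_E12:
  "lder (Emat N2' N1') (a3 [N2']) (\<lambda>g. 0)"
  "lder (Emat N2' N1') (a3 [N1']) (a3 [N2'])"
  "lder (Emat N2' N1') (a3 [P1']) (\<lambda>g. 0 * a3 [P1'] g)"
  "lder (Emat N2' N1') (a3 [N2', N1']) (\<lambda>g. 0 * a3 [N2', N1'] g)"
  "lder (Emat N2' N1') (a3 [N2', P1']) (\<lambda>g. 0)"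
  "lder (Emat N2' N1') (a3 [N1', P1']) (a3 [N2', P1'])"
  unfolding a3_def
  by ((rule lder_cong[OF lder_minor1], simp; fail) | (rule lder_cong[OF lder_minor2], simp; fail))+

lemma lder_a3_E11:
  "lder (Emat N2' N2') (a3 [N2']) (\<lambda>g. 1 * a3 [N2'] g)"
  "lder (Emat N2' N2') (a3 [N1']) (\<lambda>g. 0 * a3 [N1'] g)"
  "lder (Emat N2' N2') (a3 [P1']) (\<lambda>g. 0 * a3 [P1'] g)"
  "lder (Emat N2' N2') (a3 [N2', N1']) (\<lambda>g. 1 * a3 [N2', N1'] g)"
  "lder (Emat N2' N2') (a3 [N2', P1']) (\<lambda>g. 1 * a3 [N2', P1'] g)"
  "lder (Emat N2' N2') (a3 [N1', P1']) (\<lambda>g. 0 * a3 [N1', P1'] g)"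
  unfolding a3_def
  by ((rule lder_cong[OF lder_minor1], simp; fail) | (rule lder_cong[OF lder_minor2], simp; fail))+

lemma lder_a3_E22:
  "lder (Emat N1' N1') (a3 [N2']) (\<lambda>g. 0 * a3 [N2'] g)"
  "lder (Emat N1' N1') (a3 [N1']) (\<lambda>g. 1 * a3 [N1'] g)"
  "lder (Emat N1' N1') (a3 [P1']) (\<lambda>g. 0 * a3 [P1'] g)"
  "lder (Emat N1' N1') (a3 [N2', N1']) (\<lambda>g. 1 * a3 [N2', N1'] g)"
  "lder (Emat N1' N1') (a3 [N2', P1']) (\<lambda>g. 0 * a3 [N2', P1'] g)"
  "lder (Emat N1' N1') (a3 [N1', P1']) (\<lambda>g. 1 * a3 [N1', P1'] g)"
  unfolding a3_def
  by ((rule lder_cong[OF lder_minor1], simp; fail) | (rule lder_cong[OF lder_minor2], simp; fail))+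

lemma lder_gt_fun_E21:
  "lder (Emat N1' N2') (gt_fun c p a b n) (\<lambda>g. of_nat (Suc n) * gt_fun c p a b (Suc n) g)"
  unfolding gt_fun_conv
  by (rule lder_cong[OF lder_mult[OF
        lder_dpow_weight[OF lder_a3_E21(3,4)]
        lder_conv_lower[OF lder_dpow_lower[OF lder_a3_E21(1,2)] lder_dpow_lower[OF lder_a3_E21(5,6)]]]])
    (simp add: algebra_simps)

lemma lder_gt_fun_E12:
  "lder (Emat N2' N1') (gt_fun c p a b n)
    (\<lambda>g. if n = 0 then 0 else (of_nat (a + b) + 1 - of_nat n) * gt_fun c p a b (n - 1) g)"
  unfolding gt_fun_conv
  by (rule lder_cong[OF lder_mult[OF
        lder_dpow_weight[OF lder_a3_E12(3,4)]
        lder_conv_raise[OF lder_dpow_raise[OF lder_a3_E12(1,2)] lder_dpow_raise[OF lder_a3_E12(5,6)]]]])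
    (simp add: algebra_simps)

lemma lder_gt_fun_E11:
  "lder (Emat N2' N2') (gt_fun c p a b n)
    (\<lambda>g. (of_nat (a + b + p) - of_nat n) * gt_fun c p a b n g)"
proof -
  have *: "lder (Emat N2' N2') (\<lambda>g. dpow e i (x g) (y g))
      (\<lambda>g. (of_nat e + (-1) * of_nat i) * dpow e i (x g) (y g))"
    if "lder (Emat N2' N2') x (\<lambda>g. 1 * x g)" "lder (Emat N2' N2') y (\<lambda>g. 0 * y g)" for e i x y
    by (rule lder_cong[OF lder_dpow_weight[OF that]]) (simp add: algebra_simps)
  show ?thesis
    unfolding gt_fun_conv
    by (rule lder_cong[OF lder_mult[OF
          lder_dpow_weight[OF lder_a3_E11(3,4)]
          lder_conv_weight[OF *[OF lder_a3_E11(1,2)] *[OF lder_a3_E11(5,6)]]]])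
      (simp add: algebra_simps)
qed

lemma lder_gt_fun_E22:
  "lder (Emat N1' N1') (gt_fun c p a b n) (\<lambda>g. of_nat (p + n) * gt_fun c p a b n g)"
proof -
  have *: "lder (Emat N1' N1') (\<lambda>g. dpow e i (x g) (y g))
      (\<lambda>g. (0 + 1 * of_nat i) * dpow e i (x g) (y g))"
    if "lder (Emat N1' N1') x (\<lambda>g. 0 * x g)" "lder (Emat N1' N1') y (\<lambda>g. 1 * y g)" for e i x y
    by (rule lder_cong[OF lder_dpow_weight[OF that]]) (simp add: algebra_simps)
  show ?thesis
    unfolding gt_fun_conv
    by (rule lder_cong[OF lder_mult[OF
          lder_dpow_weight[OF lder_a3_E22(3,4)]
          lder_conv_weight[OF *[OF lder_a3_E22(1,2)] *[OF lder_a3_E22(5,6)]]]])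
      (simp add: algebra_simps)
qed

lemma polyfun_gt_fun: "polyfun (gt_fun c p a b n)"
  using lder_gt_fun_E22 by (rule lder_polyfun)


section \<open>The irreducible \<open>gl\<^sub>2\<close>-module spanned by the Gelfand-Tsetlin functions\<close>

definition gt_comb ::
  "nat \<Rightarrow> nat \<Rightarrow> nat \<Rightarrow> nat \<Rightarrow> (nat \<Rightarrow> complex) \<Rightarrow> complex^idx3^idx3 \<Rightarrow> complex"
where
  "gt_comb c p a b d = on_group GL3 (\<lambda>g. \<Sum>n\<le>a + b. d n * gt_fun c p a b n g)"

abbreviation gl2_submodule :: "(complex^idx3^idx3 \<Rightarrow> complex) set \<Rightarrow> bool" where
  "gl2_submodule \<equiv> lie_submodule GL3 (gl {N2', N1'})"

lemma Emat_in_gl: "i \<in> I \<Longrightarrow> j \<in> I \<Longrightarrow> Emat i j \<in> gl I"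
  unfolding gl_def by (rule cmat.span_base) auto

lemma gt_comb_single:
  "on_group GL3 (gt_fun c p a b n) = gt_comb c p a b (\<lambda>m. if m = n then 1 else 0)"
proof -
  have "(\<Sum>m\<le>a + b. (if m = n then 1 else 0) * gt_fun c p a b m g) = gt_fun c p a b n g" for g
  proof -
    have "(\<Sum>m\<le>a + b. (if m = n then 1 else 0) * gt_fun c p a b m g) =
        (\<Sum>m\<le>a + b. if m = n then gt_fun c p a b m g else 0)"
      by (intro sum.cong) auto
    then show ?thesis by (simp add: gt_fun_eq_0)
  qed
  then show ?thesis by (simp add: gt_comb_def)
qed

text \<open>Each of the four matrix units sends every \<open>gt_fun\<close> to a multiple of a
  single one; induction over the span combines these matrices linearly.\<close>

lemma lder_gt_fun_gl2:
  assumes "X \<in> gl {N2', N1'}"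
  shows "\<exists>D. \<forall>n. lder X (gt_fun c p a b n) (\<lambda>g. \<Sum>m\<le>a + b. D n m * gt_fun c p a b m g)"
proof -
  have single: "\<exists>D. \<forall>n. lder X (gt_fun c p a b n) (\<lambda>g. \<Sum>m\<le>a + b. D n m * gt_fun c p a b m g)"
    if "\<And>n. lder X (gt_fun c p a b n) (\<lambda>g. v n * gt_fun c p a b (k n) g)" for X k v
  proof (intro exI allI)
    fix n
    show "lder X (gt_fun c p a b n)
        (\<lambda>g. \<Sum>m\<le>a + b. (if m = k n then v n else 0) * gt_fun c p a b m g)"
    proof (rule lder_cong[OF that])
      fix g
      have "(\<Sum>m\<le>a + b. (if m = k n then v n else 0) * gt_fun c p a b m g) =
          (\<Sum>m\<le>a + b. if m = k n then v n * gt_fun c p a b m g else 0)"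
        by (intro sum.cong) auto
      then show "v n * gt_fun c p a b (k n) g =
          (\<Sum>m\<le>a + b. (if m = k n then v n else 0) * gt_fun c p a b m g)"
        by (simp add: gt_fun_eq_0)
    qed
  qed
  have E12: "lder (Emat N2' N1') (gt_fun c p a b n)
    (\<lambda>g. (if n = 0 then 0 else of_nat (a + b) + 1 - of_nat n) * gt_fun c p a b (n - 1) g)" for n
    by (rule lder_cong[OF lder_gt_fun_E12]) simp
  show ?thesis
    using assms unfolding gl_def
  proof (induction rule: cmat.span_induct_alt)
    case base
    \<comment> \<open>The zero matrix is taken as a multiple of a generator, whose action is already
      known.\<close>
    have "lder (smat 0 (Emat N1' N1')) (gt_fun c p a b n) (\<lambda>g. \<Sum>m\<le>a + b. 0 * gt_fun c p a b m g)" for n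
      by (rule lder_cong[OF lder_smat_left[OF lder_gt_fun_E22]]) simp
    then show ?case by (intro exI[of _ "\<lambda>n m. 0"]) simp
  next
    case (step r X Y)
    then obtain D where D:
      "\<And>n. lder Y (gt_fun c p a b n) (\<lambda>g. \<Sum>m\<le>a + b. D n m * gt_fun c p a b m g)"
      by blast
    have "\<exists>D. \<forall>n. lder X (gt_fun c p a b n) (\<lambda>g. \<Sum>m\<le>a + b. D n m * gt_fun c p a b m g)"
      using step(1) single[OF E12] single[OF lder_gt_fun_E21] single[OF lder_gt_fun_E11]
        single[OF lder_gt_fun_E22]
      by blast
    then obtain D' where D':
      "\<And>n. lder X (gt_fun c p a b n) (\<lambda>g. \<Sum>m\<le>a + b. D' n m * gt_fun c p a b m g)"
      by blast
    have "lder (smat r X + Y) (gt_fun c p a b n)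
        (\<lambda>g. \<Sum>m\<le>a + b. (r * D' n m + D n m) * gt_fun c p a b m g)" for n
      by (rule lder_cong[OF lder_add_left[OF lder_smat_left[OF D'] D]])
        (simp add: sum_distrib_left sum.distrib algebra_simps)
    then show ?case by (intro exI[of _ "\<lambda>n m. r * D' n m + D n m"]) simp
  qed
qed

lemma gl2_submodule_gt_comb: "gl2_submodule (range (gt_comb c p a b))"
  unfolding lie_submodule_def
proof (intro conjI ballI)
  have "gt_comb c p a b d + gt_comb c p a b e = gt_comb c p a b (\<lambda>n. d n + e n)" for d e
    by (simp add: gt_comb_def on_group_add[symmetric] sum.distrib[symmetric] distrib_right)
  moreover have "sfun r (gt_comb c p a b d) = gt_comb c p a b (\<lambda>n. r * d n)" for r d
    by (simp add: gt_comb_def on_group_cmult[symmetric] sum_distrib_left mult_ac)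
  moreover have "0 = gt_comb c p a b (\<lambda>n. 0)"
    by (simp add: gt_comb_def on_group_0)
  ultimately show "cfun.subspace (range (gt_comb c p a b))"
    by (intro cfun.subspaceI) (auto intro: range_eqI)
next
  fix X f
  assume X: "X \<in> gl {N2', N1'}" and "f \<in> range (gt_comb c p a b)"
  then obtain d where f: "f = gt_comb c p a b d" by blast
  obtain D where D:
    "\<And>n. lder X (gt_fun c p a b n) (\<lambda>g. \<Sum>m\<le>a + b. D n m * gt_fun c p a b m g)"
    using lder_gt_fun_gl2[OF X] by blast
  have "lder X (\<lambda>g. \<Sum>n\<le>a + b. d n * gt_fun c p a b n g)
      (\<lambda>g. \<Sum>n\<le>a + b. d n * (\<Sum>m\<le>a + b. D n m * gt_fun c p a b m g))"
    by (intro lder_sum lder_cmult D)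
  then have "lder X (\<lambda>g. \<Sum>n\<le>a + b. d n * gt_fun c p a b n g)
      (\<lambda>g. \<Sum>m\<le>a + b. (\<Sum>n\<le>a + b. d n * D n m) * gt_fun c p a b m g)"
  proof (rule lder_cong)
    fix g
    have "(\<Sum>n\<le>a + b. d n * (\<Sum>m\<le>a + b. D n m * gt_fun c p a b m g)) =
        (\<Sum>n\<le>a + b. \<Sum>m\<le>a + b. d n * D n m * gt_fun c p a b m g)"
      by (simp add: sum_distrib_left mult.assoc)
    also have "\<dots> = (\<Sum>m\<le>a + b. \<Sum>n\<le>a + b. d n * D n m * gt_fun c p a b m g)"
      by (rule sum.swap)
    finally show "(\<Sum>n\<le>a + b. d n * (\<Sum>m\<le>a + b. D n m * gt_fun c p a b m g)) =
        (\<Sum>m\<le>a + b. (\<Sum>n\<le>a + b. d n * D n m) * gt_fun c p a b m g)"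
      by (simp add: sum_distrib_right)
  qed
  from lie_act_GL3[OF this] show "lie_act GL3 X f \<in> range (gt_comb c p a b)"
    unfolding f gt_comb_def by (intro range_eqI[of _ _ "\<lambda>m. \<Sum>n\<le>a + b. d n * D n m"])
qed

text \<open>Lowering produces the next function with the invertible factor \<open>Suc n\<close>, so
  the highest vector generates the whole string.\<close>

lemma gt_comb_in_gl2_submodule:
  assumes W: "gl2_submodule W" and "on_group GL3 (gt_fun c p a b 0) \<in> W"
  shows "range (gt_comb c p a b) \<subseteq> W"
proof -
  have sub: "cfun.subspace W" using W by (simp add: lie_submodule_def)
  have "on_group GL3 (gt_fun c p a b n) \<in> W" for n
  proof (induction n)
    case (Suc n)
    let ?f = "on_group GL3 (gt_fun c p a b n)"
    have "sfun (1 / of_nat (Suc n)) (lie_act GL3 (Emat N1' N2') ?f) \<in> W"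
      using W Suc sub by (auto simp: lie_submodule_def intro!: cfun.subspace_scale Emat_in_gl)
    also have "sfun (1 / of_nat (Suc n)) (lie_act GL3 (Emat N1' N2') ?f) =
        on_group GL3 (gt_fun c p a b (Suc n))"
      unfolding lie_act_GL3[OF lder_gt_fun_E21] on_group_cmult[symmetric] mult.assoc[symmetric]
      by (simp add: one_plus_of_nat_neq_0)
    finally show ?case .
  qed (rule assms(2))
  then show ?thesis
    by (auto simp: gt_comb_def intro!: on_group_sum_in_subspace[OF sub])
qed

text \<open>Applying the raising operator as often as possible leaves a multiple of the highest vector.\<close>

lemma gt_highest_in_gl2_submodule:
  assumes W: "gl2_submodule W"
    and "gt_comb c p a b d \<in> W" "k \<le> a + b" "d k \<noteq> 0" "\<And>n. k < n \<Longrightarrow> n \<le> a + b \<Longrightarrow> d n = 0"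
  shows "on_group GL3 (gt_fun c p a b 0) \<in> W"
  using assms(2-)
proof (induction k arbitrary: d)
  case 0
  have "(\<Sum>n\<le>a + b. d n * gt_fun c p a b n g) = d 0 * gt_fun c p a b 0 g" for g
  proof -
    have "(\<Sum>n\<le>a + b. d n * gt_fun c p a b n g) = (\<Sum>n\<in>{0}. d n * gt_fun c p a b n g)"
      using 0(4) by (intro sum.mono_neutral_right) auto
    then show ?thesis by simp
  qed
  then have "sfun (1 / d 0) (gt_comb c p a b d) = on_group GL3 (gt_fun c p a b 0)"
    unfolding gt_comb_def on_group_cmult[symmetric] using 0 by simp
  moreover have "sfun (1 / d 0) (gt_comb c p a b d) \<in> W"
    using W 0 by (auto simp: lie_submodule_def cfun.subspace_scale)
  ultimately show ?case by simp
next
  case (Suc k)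
  \<comment> \<open>Coefficients after raising. The factor is nonzero for \<open>n < a + b\<close>,
    so the top index drops by exactly one.\<close>
  define e where "e n = d (Suc n) * (of_nat (a + b) - of_nat n)" for n
  have "lder (Emat N2' N1') (\<lambda>g. \<Sum>n\<le>a + b. d n * gt_fun c p a b n g)
      (\<lambda>g. \<Sum>n\<le>a + b. e n * gt_fun c p a b n g)"
  proof (rule lder_cong[OF lder_sum[OF lder_cmult[OF lder_gt_fun_E12]]], goal_cases)
    case (1 g)
    obtain N where N: "a + b = Suc N" using Suc.prems(2) by (cases "a + b") auto
    have "(\<Sum>n\<le>Suc N. d n * (if n = 0 then 0
          else (of_nat (a + b) + 1 - of_nat n) * gt_fun c p a b (n - 1) g)) =
        (\<Sum>n\<le>N. e n * gt_fun c p a b n g)"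
      by (subst sum.atMost_Suc_shift) (simp add: e_def mult.assoc add_diff_eq)
    \<comment> \<open>The added summand is \<open>n = a + b\<close>, where the factor in
      \<open>e\<close> is 0.\<close>
    also have "\<dots> = (\<Sum>n\<le>Suc N. e n * gt_fun c p a b n g)"
      by (simp add: e_def N)
    finally show ?case by (simp only: N)
  qed
  from lie_act_GL3[OF this] have "lie_act GL3 (Emat N2' N1') (gt_comb c p a b d) = gt_comb c p a b e"
    by (simp add: gt_comb_def)
  moreover have "lie_act GL3 (Emat N2' N1') (gt_comb c p a b d) \<in> W"
    using W Suc.prems(1) by (auto simp: lie_submodule_def intro!: Emat_in_gl)
  ultimately have "gt_comb c p a b e \<in> W" by simp
  moreover have "e k \<noteq> 0"
  proof -
    have "(of_nat (a + b) :: complex) \<noteq> of_nat k"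
      unfolding of_nat_eq_iff using Suc.prems(2) by simp
    then show ?thesis using Suc.prems(3) by (simp add: e_def)
  qed
  moreover have "e n = 0" if "k < n" "n \<le> a + b" for n
    using Suc.prems(4)[of "Suc n"] that by (cases "n = a + b") (auto simp: e_def)
  ultimately show ?case
    using Suc.IH[of e] Suc.prems(2) by simp
qed

lemma gt_highest_in_gl2_submodule':
  assumes "gl2_submodule W" "gt_comb c p a b d \<in> W" "k \<le> a + b" "d k \<noteq> 0"
  shows "on_group GL3 (gt_fun c p a b 0) \<in> W"
proof -
  let ?K = "{k. k \<le> a + b \<and> d k \<noteq> 0}"
  have fin: "finite ?K" by simp
  have "Max ?K \<in> ?K" by (rule Max_in[OF fin]) (use assms in auto)
  moreover have "d n = 0" if "Max ?K < n" "n \<le> a + b" for n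
    using Max_ge[OF fin, of n] that by fastforce
  ultimately show ?thesis
    using gt_highest_in_gl2_submodule[OF assms(1,2), of "Max ?K"] by blast
qed


section \<open>Highest vectors as functions on the flag variety\<close>

lemma sum_idx3: "(\<Sum>i\<in>UNIV. f i) = f N2' + f N1' + f P1'"
  by (simp add: UNIV_idx3 add.assoc)

lemma all_idx3: "(\<forall>i. P i) \<longleftrightarrow> P N2' \<and> P N1' \<and> P P1'"
  by (metis idx3.exhaust)

definition mat3 ::
  "complex \<Rightarrow> complex \<Rightarrow> complex \<Rightarrow> complex \<Rightarrow> complex \<Rightarrow> complex \<Rightarrow> complex \<Rightarrow> complex \<Rightarrow> complex
     \<Rightarrow> complex^idx3^idx3"
where
  "mat3 a b c d e f u v w = (\<chi> i j.
     (case i of N2' \<Rightarrow> (case j of N2' \<Rightarrow> a | N1' \<Rightarrow> b | P1' \<Rightarrow> c)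
              | N1' \<Rightarrow> (case j of N2' \<Rightarrow> d | N1' \<Rightarrow> e | P1' \<Rightarrow> f)
              | P1' \<Rightarrow> (case j of N2' \<Rightarrow> u | N1' \<Rightarrow> v | P1' \<Rightarrow> w)))"

lemma mat3_nth [simp]:
  "mat3 a b c d e f u v w $ N2' $ N2' = a" "mat3 a b c d e f u v w $ N2' $ N1' = b"
  "mat3 a b c d e f u v w $ N2' $ P1' = c" "mat3 a b c d e f u v w $ N1' $ N2' = d"
  "mat3 a b c d e f u v w $ N1' $ N1' = e" "mat3 a b c d e f u v w $ N1' $ P1' = f"
  "mat3 a b c d e f u v w $ P1' $ N2' = u" "mat3 a b c d e f u v w $ P1' $ N1' = v"
  "mat3 a b c d e f u v w $ P1' $ P1' = w"
  by (simp_all add: mat3_def)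

lemma mat3_in_GL3:
  assumes "a * e - b * d \<noteq> 0"
  shows "mat3 a b c d e f 0 0 1 \<in> GL3"
proof -
  let ?D = "a * e - b * d"
  \<comment> \<open>Block inverse: the inverse of the upper left 2 x 2 block, and minus that inverse
    applied to \<open>(c, f)\<close> as third column.\<close>
  let ?h = "mat3 (e / ?D) (- b / ?D) ((b * f - c * e) / ?D)
    (- d / ?D) (a / ?D) ((c * d - a * f) / ?D) 0 0 1"
  have "mat3 a b c d e f 0 0 1 ** ?h = mat 1" "?h ** mat3 a b c d e f 0 0 1 = mat 1"
    using assms
    by (simp_all add: vec_eq_iff all_idx3 matrix_matrix_mult_def sum_idx3 mat_def
        diff_divide_distrib[symmetric] add_divide_distrib[symmetric])
      (auto simp: field_simps)
  then show ?thesis by (auto simp: GL3_def invertible_def)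
qed

section \<open>Density of the generic matrices\<close>

lemma finite_imp_eventually_notin:
  fixes x :: "'a :: t1_space"
  assumes "finite S"
  shows "\<forall>\<^sub>F t in at x. t \<notin> S"
proof -
  have "open (- (S - {x}))"
    using assms by (intro open_Compl finite_imp_closed) simp
  then show ?thesis
    unfolding eventually_at_topological by blast
qed

lemma eventually_monic_quadratic_neq_0:
  fixes p q :: complex
  shows "\<forall>\<^sub>F t in at 0. t ^ 2 + p * t + q \<noteq> 0"
proof -
  have "finite {t. poly [:q, p, 1:] t = 0}"
    by (rule poly_roots_finite) simp
  from finite_imp_eventually_notin[OF this, of 0] show ?thesis
    by (auto simp: algebra_simps power2_eq_square elim!: eventually_mono)
qed

lemma polyfun_eq_0_if_generic:
  assumes \<phi>: "polyfun \<phi>"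
    and 0: "\<And>g. a3 [N2'] g \<noteq> 0 \<Longrightarrow> a3 [P1'] g \<noteq> 0 \<Longrightarrow> a3 [N2', N1'] g \<noteq> 0 \<Longrightarrow>
      a3 [N2', P1'] g \<noteq> 0 \<Longrightarrow> \<phi> g = 0"
  shows "\<phi> g = 0"
proof -
  \<comment> \<open>All four determinants are 1 at \<open>M\<close>, so along \<open>g + t M\<close>
    each is a monic polynomial in \<open>t\<close> of degree 1 or 2 and has no zero at small
    \<open>t \<noteq> 0\<close>.\<close>
  define M where "M = mat3 1 0 1 0 1 1 0 0 1"
  define \<gamma> where "\<gamma> t = g + smat t M" for t
  have "curve_deriv \<gamma> M 0"
    unfolding curve_deriv_def \<gamma>_def by (auto intro!: derivative_eq_intros)
  then have "isCont (\<lambda>t. \<phi> (\<gamma> t)) 0"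
    using \<phi> polyfun_isCont_curve by blast
  then have lim: "((\<lambda>t. \<phi> (\<gamma> t)) \<longlongrightarrow> \<phi> g) (at 0)"
    by (simp add: isCont_def \<gamma>_def)
  have lin: "\<forall>\<^sub>F t in at 0. t + p \<noteq> 0" for p :: complex
    using finite_imp_eventually_notin[of "{- p}" 0] by (auto simp: add_eq_0_iff2 elim!: eventually_mono)
  have "\<forall>\<^sub>F t in at 0. \<phi> (\<gamma> t) = 0"
    using lin[of "g $ N2' $ N2'"] lin[of "g $ N2' $ P1'"]
      eventually_monic_quadratic_neq_0[of "g $ N2' $ N2' + g $ N1' $ N1'" "a3 [N2', N1'] g"]
      eventually_monic_quadratic_neq_0[of "g $ N2' $ N2' + g $ N1' $ P1' - g $ N1' $ N2'" "a3 [N2', P1'] g"]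
  proof eventually_elim
    case (elim t)
    show ?case
      by (rule 0) (use elim in \<open>auto simp: a3_def \<gamma>_def M_def algebra_simps power2_eq_square\<close>)
  qed
  then have "((\<lambda>t. \<phi> (\<gamma> t)) \<longlongrightarrow> 0) (at 0)"
    by (rule tendsto_eventually)
  with lim show ?thesis
    using tendsto_unique by force
qed

section \<open>Left-equivariant polynomials and uniqueness of highest vectors\<close>

definition lower_tri :: "complex^idx3^idx3 \<Rightarrow> bool" where
  "lower_tri L \<longleftrightarrow> L $ N2' $ N1' = 0 \<and> L $ N2' $ P1' = 0 \<and> L $ N1' $ P1' = 0"

text \<open>Borel-Weil picture: sections of the line bundle on the flag variety that belongs to the
  weight \<open>[m2, m1, 0]\<close>.\<close>

definition flag_fun :: "nat \<Rightarrow> nat \<Rightarrow> (complex^idx3^idx3 \<Rightarrow> complex) \<Rightarrow> bool" where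
  "flag_fun m2 m1 \<phi> \<longleftrightarrow> polyfun \<phi> \<and>
     (\<forall>L g. lower_tri L \<longrightarrow> \<phi> (L ** g) = L $ N2' $ N2' ^ m2 * L $ N1' $ N1' ^ m1 * \<phi> g)"

lemma a3_lower_tri:
  assumes "lower_tri L"
  shows "a3 [i] (L ** g) = L $ N2' $ N2' * a3 [i] g"
    and "a3 [i, j] (L ** g) = L $ N2' $ N2' * L $ N1' $ N1' * a3 [i, j] g"
  using assms by (simp_all add: a3_def lower_tri_def matrix_matrix_mult_def sum_idx3 algebra_simps)

text \<open>Left multiplication by \<open>L\<close> commutes with right shifts.\<close>

lemma flag_fun_ldiff:
  assumes "flag_fun m2 m1 \<phi>"
  shows "flag_fun m2 m1 (ldiff X \<phi>)"
proof -
  have \<phi>: "polyfun \<phi>" using assms by (simp add: flag_fun_def)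
  have "ldiff X \<phi> (L ** g) = L $ N2' $ N2' ^ m2 * L $ N1' $ N1' ^ m1 * ldiff X \<phi> g"
    if "lower_tri L" for L g
  proof -
    have "ldiff X \<phi> (L ** g) = deriv (\<lambda>t. L $ N2' $ N2' ^ m2 * L $ N1' $ N1' ^ m1 *
        \<phi> (g ** mexp (smat t X))) 0"
      using assms that by (simp add: ldiff_def flag_fun_def matrix_mul_assoc[symmetric])
    also have "\<dots> = L $ N2' $ N2' ^ m2 * L $ N1' $ N1' ^ m1 * ldiff X \<phi> g"
      by (intro DERIV_imp_deriv DERIV_cmult DERIV_ldiff \<phi>)
    finally show ?thesis .
  qed
  then show ?thesis using polyfun_ldiff[OF \<phi>] by (simp add: flag_fun_def)
qed

lemma lie_submodule_flag_fun: "lie_submodule GL3 I (on_group GL3 ` Collect (flag_fun m2 m1))"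
  unfolding lie_submodule_def
proof (intro conjI ballI)
  show "cfun.subspace (on_group GL3 ` Collect (flag_fun m2 m1))"
  proof (intro cfun.subspaceI)
    have "flag_fun m2 m1 (\<lambda>g. 0)"
      by (simp add: flag_fun_def polyfun_const)
    then show "0 \<in> on_group GL3 ` Collect (flag_fun m2 m1)"
      unfolding on_group_0[of GL3, symmetric] by blast
    show "f + h \<in> on_group GL3 ` Collect (flag_fun m2 m1)"
      if fh: "f \<in> on_group GL3 ` Collect (flag_fun m2 m1)" "h \<in> on_group GL3 ` Collect (flag_fun m2 m1)"
      for f h
    proof -
      obtain \<phi> \<psi> where "flag_fun m2 m1 \<phi>" "flag_fun m2 m1 \<psi>" "f = on_group GL3 \<phi>" "h = on_group GL3 \<psi>"
        using fh by blast
      moreover from this have "flag_fun m2 m1 (\<lambda>g. \<phi> g + \<psi> g)"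
        by (simp add: flag_fun_def polyfun_add distrib_left)
      ultimately show ?thesis by (auto simp: on_group_add[symmetric])
    qed
    show "sfun r f \<in> on_group GL3 ` Collect (flag_fun m2 m1)"
      if f: "f \<in> on_group GL3 ` Collect (flag_fun m2 m1)" for r f
    proof -
      obtain \<phi> where "flag_fun m2 m1 \<phi>" "f = on_group GL3 \<phi>"
        using f by blast
      moreover from this have "flag_fun m2 m1 (\<lambda>g. r * \<phi> g)"
        by (simp add: flag_fun_def polyfun_mult polyfun_const mult_ac)
      ultimately show ?thesis by (auto simp: on_group_cmult[symmetric])
    qed
  qed
  show "lie_act GL3 X f \<in> on_group GL3 ` Collect (flag_fun m2 m1)"
    if f: "f \<in> on_group GL3 ` Collect (flag_fun m2 m1)" for X f
  proof -
    obtain \<phi> where \<phi>: "flag_fun m2 m1 \<phi>" "f = on_group GL3 \<phi>"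
      using f by blast
    then have "lder X \<phi> (ldiff X \<phi>)"
      by (simp add: lder_ldiff flag_fun_def)
    from lie_act_GL3[OF this] \<phi> flag_fun_ldiff[OF \<phi>(1)] show ?thesis by auto
  qed
qed

text \<open>The generator \<open>v_0\<close> is left-equivariant, and the hull lies in every
  submodule that contains it.\<close>

lemma gl3_rep_flag_fun:
  assumes "m1 \<le> m2" "u \<in> gl3_rep m2 m1"
  shows "\<exists>\<phi>. flag_fun m2 m1 \<phi> \<and> u = on_group GL3 \<phi>"
proof -
  have pf: "polyfun (a3 [i])" "polyfun (a3 [i, j])" for i j
    using lder_polyfun[OF lder_minor1] lder_polyfun[OF lder_minor2] by (auto simp: a3_def)
  have "flag_fun m2 m1 (\<lambda>g. a3 [N2'] g ^ (m2 - m1) * a3 [N2', N1'] g ^ m1)"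
    unfolding flag_fun_def
  proof (intro conjI allI impI)
    fix L g assume "lower_tri L"
    have "L $ N2' $ N2' ^ m2 = L $ N2' $ N2' ^ (m2 - m1) * L $ N2' $ N2' ^ m1"
      using assms(1) by (simp add: power_add[symmetric])
    then show "a3 [N2'] (L ** g) ^ (m2 - m1) * a3 [N2', N1'] (L ** g) ^ m1 =
        L $ N2' $ N2' ^ m2 * L $ N1' $ N1' ^ m1 * (a3 [N2'] g ^ (m2 - m1) * a3 [N2', N1'] g ^ m1)"
      using \<open>lower_tri L\<close> by (simp add: a3_lower_tri power_mult_distrib)
  qed (intro polyfun_mult polyfun_power pf)
  then have "gl3_rep m2 m1 \<subseteq> on_group GL3 ` Collect (flag_fun m2 m1)"
    unfolding gl3_rep_def by (intro hull_minimal lie_submodule_flag_fun) auto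
  with assms(2) show ?thesis by auto
qed

text \<open>\<open>exp (- r * t)\<close> times the value along the curve has derivative 0. The curve
  must stay in \<open>GL3\<close>, since the eigenvalue equation is given only there.\<close>

lemma polyfun_integrate:
  assumes "polyfun \<phi>" "\<And>t. curve_deriv \<gamma> (\<gamma> t ** X) t" "\<And>t. \<gamma> t \<in> GL3"
    and "lie_act GL3 X (on_group GL3 \<phi>) = sfun r (on_group GL3 \<phi>)"
  shows "\<phi> (\<gamma> t) = exp (r * t) * \<phi> (\<gamma> 0)"
proof -
  have "on_group GL3 (ldiff X \<phi>) = sfun r (on_group GL3 \<phi>)"
    using lie_act_GL3[OF lder_ldiff[OF assms(1), of X]] assms(4) by simp
  then have ev: "ldiff X \<phi> (\<gamma> t) = r * \<phi> (\<gamma> t)" for t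
    using assms(3)[of t] by (auto simp: on_group_def sfun_def fun_eq_iff split: if_splits)
  have "((\<lambda>t. exp (- r * t) * \<phi> (\<gamma> t)) has_field_derivative 0) (at t)" for t
    using DERIV_curve[OF assms(1,2), of t]
    by (auto simp: ev intro!: derivative_eq_intros)
  then obtain k where k: "\<And>t. exp (- r * t) * \<phi> (\<gamma> t) = k"
    using has_field_derivative_zero_constant[of UNIV "\<lambda>t. exp (- r * t) * \<phi> (\<gamma> t)"] by auto
  from k[of 0] k[of t] have "exp (- r * t) * \<phi> (\<gamma> t) = \<phi> (\<gamma> 0)" by simp
  then show ?thesis by (simp add: exp_minus field_simps)
qed

text \<open>A generic \<open>g\<close> factors as \<open>L ** M'\<close> with \<open>L\<close> lower
  triangular and \<open>M'\<close> upper triangular with last column 1. Equivariance removes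
  \<open>L\<close>, and the flows of the three operators carry \<open>M'\<close> to the base matrix.
  Of the logarithm only \<open>exp (ln w) = w\<close> for \<open>w \<noteq> 0\<close> is used, so
  its branch does not matter.\<close>

lemma flag_fun_highest_value:
  assumes \<phi>: "flag_fun m2 m1 \<phi>"
    and E12: "lie_act GL3 (Emat N2' N1') (on_group GL3 \<phi>) = 0"
    and E11: "lie_act GL3 (Emat N2' N2') (on_group GL3 \<phi>) = sfun r (on_group GL3 \<phi>)"
    and E22: "lie_act GL3 (Emat N1' N1') (on_group GL3 \<phi>) = sfun s (on_group GL3 \<phi>)"
    and gen: "a3 [N2'] g \<noteq> 0" "a3 [P1'] g \<noteq> 0" "a3 [N2', N1'] g \<noteq> 0" "a3 [N2', P1'] g \<noteq> 0"
  shows "\<phi> g = a3 [P1'] g ^ m2 * (a3 [N2', P1'] g / a3 [N2'] g) ^ m1 *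
    (exp (r * ln (a3 [N2'] g / a3 [P1'] g)) * exp (s * ln (a3 [N2', N1'] g / a3 [N2', P1'] g))) *
    \<phi> (mat3 1 0 1 0 1 1 0 0 1)"
proof -
  define M where "M t\<^sub>1 q t\<^sub>2 = mat3 t\<^sub>1 q 1 0 t\<^sub>2 1 0 0 1" for t\<^sub>1 q t\<^sub>2
  have pf: "polyfun \<phi>" using \<phi> by (simp add: flag_fun_def)
  have "lie_act GL3 (Emat N2' N1') (on_group GL3 \<phi>) = sfun 0 (on_group GL3 \<phi>)"
    using E12 by (simp add: sfun_def zero_fun_def)
  note integrate = polyfun_integrate[OF pf _ _ this] polyfun_integrate[OF pf _ _ E11]
    polyfun_integrate[OF pf _ _ E22]
  note mult_simps = all_idx3 matrix_matrix_mult_def sum_idx3 Emat_def M_def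
  \<comment> \<open>The column -2 of \<open>M\<close> is \<open>(t\<^sub>1, 0, 0)\<close>, so the
    flow of \<open>Emat N2' N1'\<close> moves the entry at speed \<open>t\<^sub>1\<close>; hence the
    product with \<open>q\<close>.\<close>
  have 1: "\<phi> (M t\<^sub>1 (t\<^sub>1 * q) t\<^sub>2) = \<phi> (M t\<^sub>1 0 t\<^sub>2)" if "t\<^sub>1 \<noteq> 0" "t\<^sub>2 \<noteq> 0" for t\<^sub>1 t\<^sub>2 q
  proof -
    have "curve_deriv (\<lambda>q. M t\<^sub>1 (t\<^sub>1 * q) t\<^sub>2) (M t\<^sub>1 (t\<^sub>1 * q) t\<^sub>2 ** Emat N2' N1') q" for q
      unfolding curve_deriv_def by (simp add: mult_simps)
    from integrate(1)[OF this] show ?thesis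
      using that by (simp add: M_def mat3_in_GL3)
  qed
  have 2: "\<phi> (M (exp t) 0 t\<^sub>2) = exp (r * t) * \<phi> (M 1 0 t\<^sub>2)" if "t\<^sub>2 \<noteq> 0" for t t\<^sub>2
  proof -
    have "curve_deriv (\<lambda>t. M (exp t) 0 t\<^sub>2) (M (exp t) 0 t\<^sub>2 ** Emat N2' N2') t" for t
      unfolding curve_deriv_def by (simp add: mult_simps)
    from integrate(2)[OF this] show ?thesis
      using that by (simp add: M_def mat3_in_GL3)
  qed
  have 3: "\<phi> (M 1 0 (exp t)) = exp (s * t) * \<phi> (M 1 0 1)" for t
  proof -
    have "curve_deriv (\<lambda>t. M 1 0 (exp t)) (M 1 0 (exp t) ** Emat N1' N1') t" for t
      unfolding curve_deriv_def by (simp add: mult_simps)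
    from integrate(3)[OF this] show ?thesis
      by (simp add: M_def mat3_in_GL3)
  qed
  define x y z A B where "x = a3 [N2'] g" "y = a3 [N1'] g" "z = a3 [P1'] g"
    "A = a3 [N2', N1'] g" "B = a3 [N2', P1'] g"
  note defs = this
  have nz: "x \<noteq> 0" "z \<noteq> 0" "A \<noteq> 0" "B \<noteq> 0" using gen by (simp_all add: defs)
  \<comment> \<open>The ratios \<open>x/z\<close>, \<open>y/z\<close>, \<open>A/B\<close> are
    unchanged by invertible lower triangular left factors and equal the three parameters on
    \<open>M\<close>. \<open>L\<close> is then solved for row by row.\<close>
  define M' where "M' = M (x / z) (x / z * (y / x)) (A / B)"
  define L where "L = mat3 z 0 0 (g $ N1' $ N2' * z / x) (B / x) 0 (g $ P1' $ N2' * z / x)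
    ((g $ P1' $ N1' - g $ P1' $ N2' * y / x) * B / A)
    (g $ P1' $ P1' - g $ P1' $ N2' * z / x - (g $ P1' $ N1' - g $ P1' $ N2' * y / x) * B / A)"
  have "L ** M' = g"
  proof -
    have row1: "g $ N2' $ N2' = x" "g $ N2' $ N1' = y" "g $ N2' $ P1' = z"
      by (simp_all add: defs a3_def)
    have row2: "x * g $ N1' $ N1' = A + y * g $ N1' $ N2'" "x * g $ N1' $ P1' = B + z * g $ N1' $ N2'"
      by (simp_all add: defs a3_def)
    have "B / x * (A / B) = A / x" using nz by simp
    with row1 row2 nz show ?thesis
      by (simp add: vec_eq_iff all_idx3 matrix_matrix_mult_def sum_idx3 L_def M'_def M_def)
        (auto simp: field_simps)
  qed
  moreover have "lower_tri L" by (simp add: L_def lower_tri_def)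
  ultimately have "\<phi> g = L $ N2' $ N2' ^ m2 * L $ N1' $ N1' ^ m1 * \<phi> M'"
    using \<phi> unfolding flag_fun_def by metis
  also have "\<dots> = z ^ m2 * (B / x) ^ m1 * \<phi> M'" by (simp add: L_def)
  also have "\<phi> M' = \<phi> (M (exp (ln (x / z))) 0 (A / B))"
    unfolding M'_def using nz by (subst 1) simp_all
  also have "\<dots> = exp (r * ln (x / z)) * \<phi> (M 1 0 (exp (ln (A / B))))"
    using nz by (subst 2) simp_all
  also have "\<dots> = exp (r * ln (x / z)) * (exp (s * ln (A / B)) * \<phi> (M 1 0 1))"
    by (subst 3) simp
  finally show ?thesis
    by (simp add: defs M_def mult_ac)
qed

lemma flag_fun_gt_fun_0: "flag_fun (c + a + p + b) (p + b) (gt_fun c p a b 0)"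
  by (auto simp: flag_fun_def polyfun_gt_fun gt_fun_def gt_val_def dpow_def a3_lower_tri
      power_mult_distrib power_add)

text \<open>\<open>u\<close> and \<open>gt_fun c p a b 0\<close> obey the same propagation formula,
  so they differ by the ratio of their values at the base matrix, where all four determinants are
  1.\<close>

lemma gt_highest_unique:
  assumes "u \<in> gl3_rep (c + a + p + b) (p + b)"
    and "lie_act GL3 (Emat N2' N1') u = 0"
    and "lie_act GL3 (Emat N2' N2') u = sfun (of_nat (a + b + p)) u"
    and "lie_act GL3 (Emat N1' N1') u = sfun (of_nat p) u"
  shows "\<exists>r. u = sfun r (on_group GL3 (gt_fun c p a b 0))"
proof -
  obtain \<phi> where \<phi>: "flag_fun (c + a + p + b) (p + b) \<phi>" and u: "u = on_group GL3 \<phi>"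
    using gl3_rep_flag_fun[OF _ assms(1)] by auto
  let ?\<psi> = "gt_fun c p a b 0"
  let ?M = "mat3 1 0 1 0 1 1 0 0 1"
  have \<psi>: "lie_act GL3 (Emat N2' N1') (on_group GL3 ?\<psi>) = 0"
    "lie_act GL3 (Emat N2' N2') (on_group GL3 ?\<psi>) = sfun (of_nat (a + b + p)) (on_group GL3 ?\<psi>)"
    "lie_act GL3 (Emat N1' N1') (on_group GL3 ?\<psi>) = sfun (of_nat p) (on_group GL3 ?\<psi>)"
    using lie_act_GL3[OF lder_gt_fun_E12] lie_act_GL3[OF lder_gt_fun_E11] lie_act_GL3[OF lder_gt_fun_E22]
    by (simp_all add: on_group_cmult on_group_0 del: of_nat_add)
  have M: "?\<psi> ?M \<noteq> 0"
    by (simp add: gt_fun_def gt_val_def dpow_def a3_def)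
  define r where "r = \<phi> ?M / ?\<psi> ?M"
  have "\<phi> g - r * ?\<psi> g = 0" for g
  proof (rule polyfun_eq_0_if_generic)
    show "polyfun (\<lambda>g. \<phi> g - r * ?\<psi> g)"
      using \<phi> by (intro polyfun_diff polyfun_mult polyfun_const polyfun_gt_fun) (simp add: flag_fun_def)
    fix g
    assume gen: "a3 [N2'] g \<noteq> 0" "a3 [P1'] g \<noteq> 0" "a3 [N2', N1'] g \<noteq> 0" "a3 [N2', P1'] g \<noteq> 0"
    show "\<phi> g - r * ?\<psi> g = 0"
      unfolding flag_fun_highest_value[OF \<phi> assms(2-4)[unfolded u] gen]
        flag_fun_highest_value[OF flag_fun_gt_fun_0 \<psi> gen] r_def
      using M by simp
  qed
  then have "\<phi> = (\<lambda>g. r * ?\<psi> g)" by (simp add: fun_eq_iff)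
  then show ?thesis unfolding u by (auto simp: on_group_cmult)
qed


section \<open>The Gelfand-Tsetlin vectors\<close>

lemma lder_monomial:
  assumes "lder X x x'" "lder X z z'" "lder X A A'" "lder X B B'"
  shows "lder X (\<lambda>g. x g ^ e * z g ^ c * A g ^ p * B g ^ q)
    (\<lambda>g. of_nat e * x g ^ (e - 1) * x' g * z g ^ c * A g ^ p * B g ^ q +
      of_nat c * x g ^ e * z g ^ (c - 1) * z' g * A g ^ p * B g ^ q +
      of_nat p * x g ^ e * z g ^ c * A g ^ (p - 1) * A' g * B g ^ q +
      of_nat q * x g ^ e * z g ^ c * A g ^ p * B g ^ (q - 1) * B' g)"
  by (rule lder_cong[OF lder_mult[OF lder_mult[OF lder_mult[OF lder_power[OF assms(1)]
    lder_power[OF assms(2)]] lder_power[OF assms(3)]] lder_power[OF assms(4)]]])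
    (simp add: algebra_simps)

abbreviation (input) flag_monomial ::
  "nat \<Rightarrow> nat \<Rightarrow> nat \<Rightarrow> nat \<Rightarrow> complex^idx3^idx3 \<Rightarrow> complex"
where
  "flag_monomial e c p q \<equiv>
    (\<lambda>g. a3 [N2'] g ^ e * a3 [P1'] g ^ c * a3 [N2', N1'] g ^ p * a3 [N2', P1'] g ^ q)"

lemma lder_a3_E32:
  "lder (Emat P1' N1') (a3 [N2']) (\<lambda>g. 0)"
  "lder (Emat P1' N1') (a3 [N1']) (a3 [P1'])"
  "lder (Emat P1' N1') (a3 [P1']) (\<lambda>g. 0)"
  "lder (Emat P1' N1') (a3 [N2', N1']) (a3 [N2', P1'])"
  "lder (Emat P1' N1') (a3 [N2', P1']) (\<lambda>g. 0)"
  "lder (Emat P1' N1') (a3 [N1', P1']) (\<lambda>g. 0)"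
  unfolding a3_def
  by ((rule lder_cong[OF lder_minor1], simp; fail) | (rule lder_cong[OF lder_minor2], simp; fail))+

lemma lder_a3_E31:
  "lder (Emat P1' N2') (a3 [N2']) (a3 [P1'])"
  "lder (Emat P1' N2') (a3 [P1']) (\<lambda>g. 0)"
  "lder (Emat P1' N2') (a3 [N2', N1']) (\<lambda>g. - a3 [N1', P1'] g)"
  "lder (Emat P1' N2') (a3 [N2', P1']) (\<lambda>g. 0)"
  unfolding a3_def
  by ((rule lder_cong[OF lder_minor1], simp; fail) | (rule lder_cong[OF lder_minor2], simp; fail))+

lemma a3_pluecker:
  "a3 [N1'] g * a3 [N2', P1'] g = a3 [N2'] g * a3 [N1', P1'] g + a3 [P1'] g * a3 [N2', N1'] g"
  by (simp add: a3_def algebra_simps)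

text \<open>\<open>Emat P1' N1'\<close> maps \<open>A\<close> to \<open>B\<close> and kills
  \<open>x\<close> and \<open>B\<close>, so it trades one factor \<open>A\<close> for
  \<open>B\<close> up to an invertible integer.\<close>

lemma flag_monomial_in_submodule_N1:
  assumes W: "lie_submodule GL3 (gl UNIV) W" and "on_group GL3 (flag_monomial e 0 (r + j) 0) \<in> W"
  shows "on_group GL3 (flag_monomial e 0 r j) \<in> W"
  using assms(2)
proof (induction j arbitrary: r)
  case (Suc j)
  have "lder (Emat P1' N1') (flag_monomial e 0 (Suc r) j)
      (\<lambda>g. of_nat (Suc r) * flag_monomial e 0 r (Suc j) g)"
    by (rule lder_cong[OF lder_monomial[OF lder_a3_E32(1,3,4,5)]]) (simp add: algebra_simps)
  from lie_act_GL3[OF this]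
  have "on_group GL3 (flag_monomial e 0 r (Suc j)) =
      sfun (1 / of_nat (Suc r)) (lie_act GL3 (Emat P1' N1') (on_group GL3 (flag_monomial e 0 (Suc r) j)))"
    by (simp add: on_group_cmult[symmetric] one_plus_of_nat_neq_0)
  moreover have "on_group GL3 (flag_monomial e 0 (Suc r) j) \<in> W"
    using Suc.IH[of "Suc r"] Suc.prems by simp
  ultimately show ?case
    using W by (auto simp: lie_submodule_def intro!: cfun.subspace_scale Emat_in_gl)
qed simp

text \<open>The operator below is Zhelobenko's lowering operator from \<open>-2\<close> to \<open>1\<close>, up to normalization.\<close>

lemma flag_monomial_lowering:
  assumes W: "lie_submodule GL3 (gl UNIV) W" and f: "on_group GL3 (flag_monomial (Suc e) c p q) \<in> W"
  shows "on_group GL3 (flag_monomial e (Suc c) p q) \<in> W"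
proof -
  let ?f = "flag_monomial (Suc e) c p q"
  let ?x = "a3 [N2']" and ?y = "a3 [N1']" and ?z = "a3 [P1']"
  let ?A = "a3 [N2', N1']" and ?B = "a3 [N2', P1']" and ?C = "a3 [N1', P1']"
  define f1 where "f1 = (\<lambda>g. of_nat (Suc e) * flag_monomial e (Suc c) p q g
    - of_nat p * (?x g ^ Suc e * ?z g ^ c * ?A g ^ (p - 1) * ?B g ^ q) * ?C g)"
  define f2 where "f2 = (\<lambda>g. of_nat (Suc e) * flag_monomial e c p q g * ?y g
    + of_nat q * (?x g ^ Suc e * ?z g ^ c * ?A g ^ p * ?B g ^ (q - 1)) * ?C g)"
  define f3 where "f3 = (\<lambda>g. of_nat (Suc e) * flag_monomial e (Suc c) p q g
    + of_nat (Suc e) * of_nat p * (?x g ^ e * ?z g ^ c * ?A g ^ (p - 1) * ?B g ^ q) * (?y g * ?B g)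
    + of_nat q * of_nat p * (?x g ^ Suc e * ?z g ^ c * ?A g ^ (p - 1) * ?B g ^ q) * ?C g)"
  have f1: "lder (Emat P1' N2') ?f f1"
    by (rule lder_cong[OF lder_monomial[OF lder_a3_E31(1,2,3,4)]]) (simp add: f1_def algebra_simps)
  have f2: "lder (Emat N1' N2') ?f f2"
    by (rule lder_cong[OF lder_monomial[OF lder_a3_E21(1,3,4,5)]]) (simp add: f2_def algebra_simps)
  have f3: "lder (Emat P1' N1') f2 f3"
    unfolding f2_def
  proof (rule lder_cong[OF lder_add[OF
        lder_mult[OF lder_cmult[OF lder_monomial[OF lder_a3_E32(1,3,4,5)]] lder_a3_E32(2)]
        lder_mult[OF lder_cmult[OF lder_monomial[OF lder_a3_E32(1,3,4,5)]] lder_a3_E32(6)]]], goal_cases)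
    case (1 g)
    show ?case unfolding f3_def by (cases q) (simp_all add: algebra_simps)
  qed
  \<comment> \<open>Let \<open>u\<close> be the target monomial and \<open>v\<close> the term of
    \<open>f1\<close> with \<open>C\<close>, taken with its factor \<open>p\<close>:
    \<open>f1 = (e+1) u - v\<close>. Substituting \<open>y B = x C + z A\<close> gives
    \<open>f3 = (e+1)(p+1) u + (e+q+1) v\<close>. Adding \<open>e+q+1\<close> times
    \<open>f1\<close> cancels \<open>v\<close> and leaves \<open>s u\<close>.\<close>
  define s where "s = (of_nat (Suc e * Suc (Suc (e + p + q))) :: complex)"
  have "s \<noteq> 0" unfolding s_def of_nat_eq_0_iff by simp
  have "f3 g + of_nat (Suc (e + q)) * f1 g = s * flag_monomial e (Suc c) p q g" for g
    unfolding f3_def a3_pluecker f1_def s_def by (cases p) (simp_all add: algebra_simps)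
  then have "on_group GL3 (flag_monomial e (Suc c) p q) =
      sfun (1 / s) (on_group GL3 f3 + sfun (of_nat (Suc (e + q))) (on_group GL3 f1))"
    using \<open>s \<noteq> 0\<close> by (simp only: on_group_cmult[symmetric] on_group_add[symmetric]) simp
  also have "\<dots> = sfun (1 / s) (lie_act GL3 (Emat P1' N1') (lie_act GL3 (Emat N1' N2') (on_group GL3 ?f)) +
      sfun (of_nat (Suc (e + q))) (lie_act GL3 (Emat P1' N2') (on_group GL3 ?f)))"
    by (simp only: lie_act_GL3[OF f1] lie_act_GL3[OF f2] lie_act_GL3[OF f3])
  also have "\<dots> \<in> W"
    using W f by (auto simp: lie_submodule_def intro!: cfun.subspace_scale cfun.subspace_add Emat_in_gl)
  finally show ?thesis .
qed

text \<open>First \<open>b\<close> factors \<open>A\<close> are traded for \<open>B\<close> while no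
  \<open>z\<close> is present, then \<open>c\<close> factors \<open>x\<close> for \<open>z\<close>
  with the exponents of \<open>A\<close> and \<open>B\<close> fixed.\<close>

lemma gt_highest_in_gl3_rep:
  assumes W: "lie_submodule GL3 (gl UNIV) W"
    and v0: "on_group GL3 (\<lambda>g. a3 [N2'] g ^ (c + a) * a3 [N2', N1'] g ^ (p + b)) \<in> W"
  shows "on_group GL3 (gt_fun c p a b 0) \<in> W"
proof -
  have *: "on_group GL3 (flag_monomial (c + a) 0 p b) \<in> W"
    by (rule flag_monomial_in_submodule_N1[OF W]) (use v0 in simp)
  have "on_group GL3 (flag_monomial (d + a) j p b) \<in> W" if "d + j = c" for d j
    using that
  proof (induction j arbitrary: d)
    case 0
    then show ?case using * by simp
  next
    case (Suc j)
    then show ?case using flag_monomial_lowering[OF W] Suc.IH[of "Suc d"] by simp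
  qed
  from this[of 0 c] have "on_group GL3 (flag_monomial a c p b) \<in> W" by simp
  moreover have "gt_fun c p a b 0 =
      (\<lambda>g. 1 / (fact c * fact p * fact a * fact b) * flag_monomial a c p b g)"
    by (simp add: fun_eq_iff gt_fun_def gt_val_def dpow_def mult_ac)
  ultimately show ?thesis
    using W by (simp only: on_group_cmult) (simp add: lie_submodule_def cfun.subspace_scale)
qed

lemma gt_comb_subset_gl3_rep: "range (gt_comb c p a b) \<subseteq> gl3_rep (c + a + p + b) (p + b)"
proof -
  have "range (gt_comb c p a b) \<subseteq> W"
    if W: "lie_submodule GL3 (gl UNIV) W"
      and v0: "on_group GL3 (\<lambda>g. a3 [N2'] g ^ (c + a + p + b - (p + b)) * a3 [N2', N1'] g ^ (p + b)) \<in> W"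
    for W
  proof (rule gt_comb_in_gl2_submodule)
    have "gl {N2', N1'} \<subseteq> gl UNIV"
      unfolding gl_def by (rule cmat.span_mono) auto
    then show "gl2_submodule W"
      using W by (auto simp: lie_submodule_def)
    show "on_group GL3 (gt_fun c p a b 0) \<in> W"
      using v0 by (intro gt_highest_in_gl3_rep[OF W]) simp
  qed
  then show ?thesis
    unfolding gl3_rep_def hull_def by blast
qed

section \<open>Irreducibility and uniqueness of the \<open>gl2\<close>-component\<close>

lemma gt_fun_0_neq_0: "on_group GL3 (gt_fun c p a b 0) \<noteq> 0"
proof
  assume "on_group GL3 (gt_fun c p a b 0) = 0"
  then have "on_group GL3 (gt_fun c p a b 0) (mat3 1 0 1 0 1 1 0 0 1) = 0" by simp
  moreover have "mat3 1 0 1 0 1 1 0 0 1 \<in> GL3" by (rule mat3_in_GL3) simp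
  ultimately show False
    by (simp add: on_group_def gt_fun_def gt_val_def dpow_def a3_def)
qed

lemma gl2_submodule_0: "gl2_submodule {0}"
  by (auto simp: lie_submodule_def cfun.subspace_def sfun_def lie_act_def on_group_def fun_eq_iff)

text \<open>Linear independence: a nonzero coefficient would put the nonzero highest vector into the
  submodule \<open>{0}\<close>.\<close>

lemma gt_comb_eq_0D: "gt_comb c p a b d = 0 \<Longrightarrow> k \<le> a + b \<Longrightarrow> d k = 0"
  using gt_highest_in_gl2_submodule'[OF gl2_submodule_0, of c p a b d k] gt_fun_0_neq_0 by auto

text \<open>Raising any nonzero element yields the highest vector, and lowering that yields
  everything.\<close>

lemma lie_irreducible_gt_comb: "lie_irreducible GL3 (gl {N2', N1'}) (range (gt_comb c p a b))"
  unfolding lie_irreducible_def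
proof (intro conjI allI impI gl2_submodule_gt_comb)
  show "range (gt_comb c p a b) \<noteq> {0}"
    using gt_fun_0_neq_0[of c p a b] by (metis gt_comb_single rangeI singletonD)
next
  fix U
  assume U: "gl2_submodule U \<and> U \<subseteq> range (gt_comb c p a b)"
  show "U = {0} \<or> U = range (gt_comb c p a b)"
  proof (cases "U = {0}")
    case False
    have "0 \<in> U" using U by (simp add: lie_submodule_def cfun.subspace_0)
    with False obtain f where "f \<in> U" "f \<noteq> 0" by blast
    with U obtain d where d: "gt_comb c p a b d \<in> U" "gt_comb c p a b d \<noteq> 0" by blast
    then have "\<exists>k\<le>a + b. d k \<noteq> 0"
      by (rule_tac ccontr) (simp add: gt_comb_def on_group_0)
    then have "on_group GL3 (gt_fun c p a b 0) \<in> U"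
      using gt_highest_in_gl2_submodule'[of U c p a b d] U d by blast
    then show ?thesis
      using U gt_comb_in_gl2_submodule[of U c p a b] by blast
  qed simp
qed

lemma gl2_component_gt_comb:
  "gl2_component (c + a + p + b) (p + b) (a + b + p) p (range (gt_comb c p a b))"
  unfolding gl2_component_def
proof (intro conjI gt_comb_subset_gl3_rep lie_irreducible_gt_comb bexI)
  show "on_group GL3 (gt_fun c p a b 0) \<in> range (gt_comb c p a b)"
    unfolding gt_comb_single by blast
qed (use gt_fun_0_neq_0 lie_act_GL3[OF lder_gt_fun_E12, of c p a b 0] lie_act_GL3[OF lder_gt_fun_E11, of c p a b 0]
      lie_act_GL3[OF lder_gt_fun_E22, of c p a b 0] in
    \<open>simp_all add: on_group_cmult on_group_0 del: of_nat_add\<close>)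

text \<open>\<open>W\<close> contains a multiple of the unique highest vector, hence the whole
  explicit span; irreducibility of \<open>W\<close> forces equality.\<close>

lemma gl2_component_unique:
  assumes "gl2_component (c + a + p + b) (p + b) (a + b + p) p W"
  shows "W = range (gt_comb c p a b)"
proof -
  obtain u where W: "W \<subseteq> gl3_rep (c + a + p + b) (p + b)" "lie_irreducible GL3 (gl {N2', N1'}) W"
    and u: "u \<in> W" "u \<noteq> 0" "lie_act GL3 (Emat N2' N1') u = 0"
      "lie_act GL3 (Emat N2' N2') u = sfun (of_nat (a + b + p)) u"
      "lie_act GL3 (Emat N1' N1') u = sfun (of_nat p) u"
    using assms unfolding gl2_component_def by blast
  obtain r where r: "u = sfun r (on_group GL3 (gt_fun c p a b 0))"
    using gt_highest_unique[OF _ u(3-5)] W(1) u(1) by blast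
  have "r \<noteq> 0" using r u(2) by (auto simp: sfun_def fun_eq_iff)
  then have "on_group GL3 (gt_fun c p a b 0) = sfun (1 / r) u"
    unfolding r by (simp add: sfun_def)
  then have "on_group GL3 (gt_fun c p a b 0) \<in> W"
    using W(2) u(1) by (simp add: lie_irreducible_def lie_submodule_def cfun.subspace_scale)
  then have "range (gt_comb c p a b) \<subseteq> W"
    using W(2) by (intro gt_comb_in_gl2_submodule) (auto simp: lie_irreducible_def)
  then show ?thesis
    using W(2) gl2_submodule_gt_comb[of c p a b] gt_fun_0_neq_0[of c p a b]
    unfolding lie_irreducible_def gt_comb_single by (metis rangeI singletonD)
qed

lemma lie_act_gt_comb_E11:
  "lie_act GL3 (Emat N2' N2') (gt_comb c p a b d) =
    gt_comb c p a b (\<lambda>n. (of_nat (a + b + p) - of_nat n) * d n)"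
  unfolding gt_comb_def
  by (rule lie_act_GL3, rule lder_cong[OF lder_sum[OF lder_cmult[OF lder_gt_fun_E11]]])
    (simp add: mult_ac del: of_nat_add)

lemma gt_vector_iff:
  assumes "h2 + n = a + b + p" "n \<le> a + b"
  shows "gt_vector (c + a + p + b) (p + b) (a + b + p) p h2 w \<longleftrightarrow>
    (\<exists>r. r \<noteq> 0 \<and> w = sfun r (on_group GL3 (gt_fun c p a b n)))"
proof -
  have "gt_vector (c + a + p + b) (p + b) (a + b + p) p h2 w \<longleftrightarrow>
      w \<in> range (gt_comb c p a b) \<and> w \<noteq> 0 \<and> lie_act GL3 (Emat N2' N2') w = sfun (of_nat h2) w"
    unfolding gt_vector_def using gl2_component_gt_comb gl2_component_unique by blast
  also have "\<dots> \<longleftrightarrow> (\<exists>r. r \<noteq> 0 \<and> w = sfun r (on_group GL3 (gt_fun c p a b n)))"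
  proof
    assume w: "w \<in> range (gt_comb c p a b) \<and> w \<noteq> 0 \<and>
      lie_act GL3 (Emat N2' N2') w = sfun (of_nat h2) w"
    then obtain d where d: "w = gt_comb c p a b d" by blast
    \<comment> \<open>Coefficients of \<open>Emat N2' N2'\<close> minus \<open>h2\<close> applied to
      \<open>w\<close>. The eigenvalues \<open>a + b + p - k\<close> are distinct, so only
      \<open>k = n\<close> can survive.\<close>
    define e where "e k = (of_nat (a + b + p) - of_nat k - of_nat h2) * d k" for k
    have "gt_comb c p a b e = lie_act GL3 (Emat N2' N2') w + sfun (- of_nat h2) w"
      unfolding d lie_act_gt_comb_E11
      by (simp add: gt_comb_def on_group_cmult[symmetric] on_group_add[symmetric] sum_distrib_left
          sum.distrib[symmetric] sum_subtractf[symmetric] e_def algebra_simps sum_negf[symmetric])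
    also have "\<dots> = 0" using w by (simp add: sfun_def fun_eq_iff)
    finally have e: "e k = 0" if "k \<le> a + b" for k
      using gt_comb_eq_0D that by blast
    have "d k = 0" if "k \<le> a + b" "k \<noteq> n" for k
    proof -
      have "of_nat (a + b + p) \<noteq> (of_nat (k + h2) :: complex)"
        unfolding of_nat_eq_iff using that assms by simp
      then have "of_nat (a + b + p) - of_nat k - of_nat h2 \<noteq> (0 :: complex)"
        by (metis diff_diff_eq eq_iff_diff_eq_0 of_nat_add)
      then show ?thesis using e[OF that(1)] unfolding e_def by (metis mult_eq_0_iff)
    qed
    then have "w = gt_comb c p a b (\<lambda>k. d n * (if k = n then 1 else 0))"
      unfolding d gt_comb_def by (intro arg_cong[of _ _ "on_group GL3"] ext sum.cong) auto
    also have "\<dots> = sfun (d n) (on_group GL3 (gt_fun c p a b n))"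
      by (simp only: gt_comb_single) (simp add: gt_comb_def on_group_cmult[symmetric] sum_distrib_left mult.assoc)
    finally have *: "w = sfun (d n) (on_group GL3 (gt_fun c p a b n))" .
    moreover have "d n \<noteq> 0" using * w by (auto simp: sfun_def fun_eq_iff)
    ultimately show "\<exists>r. r \<noteq> 0 \<and> w = sfun r (on_group GL3 (gt_fun c p a b n))" by blast
  next
    assume "\<exists>r. r \<noteq> 0 \<and> w = sfun r (on_group GL3 (gt_fun c p a b n))"
    then obtain r where r: "r \<noteq> 0" "w = sfun r (on_group GL3 (gt_fun c p a b n))" by blast
    then have w: "w = gt_comb c p a b (\<lambda>k. r * (if k = n then 1 else 0))"
      by (simp only: gt_comb_single) (simp add: gt_comb_def on_group_cmult[symmetric] sum_distrib_left mult.assoc)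
    have "w \<noteq> 0"
      using gt_comb_eq_0D[of c p a b "\<lambda>k. r * (if k = n then 1 else 0)" n] r(1) assms(2) w by auto
    moreover have "lie_act GL3 (Emat N2' N2') w = sfun (of_nat h2) w"
    proof -
      have "of_nat (a + b + p) - of_nat n = (of_nat h2 :: complex)"
        unfolding assms(1)[symmetric] by simp
      then show ?thesis
        unfolding w lie_act_gt_comb_E11
        unfolding gt_comb_def on_group_cmult[symmetric] sum_distrib_left
        by (intro arg_cong[of _ _ "on_group GL3"] ext sum.cong) auto
    qed
    ultimately show "w \<in> range (gt_comb c p a b) \<and> w \<noteq> 0 \<and>
        lie_act GL3 (Emat N2' N2') w = sfun (of_nat h2) w"
      using w by blast
  qed
  finally show ?thesis .
qed


section \<open>Transfer of polynomials in the determinants\<close>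

lemma poly_eval_superset:
  assumes "finite T" "Poly_Mapping.keys P \<subseteq> T"
  shows "poly_eval P v = (\<Sum>e\<in>T. Poly_Mapping.lookup P e *
     (\<Prod>X\<in>Poly_Mapping.keys e. v X ^ Poly_Mapping.lookup e X))"
  unfolding poly_eval_def using assms by (intro sum.mono_neutral_left) (auto simp: in_keys_iff)

lemma poly_eval_add: "poly_eval (P + Q) v = poly_eval P v + poly_eval Q v"
proof -
  let ?T = "Poly_Mapping.keys P \<union> Poly_Mapping.keys Q"
  have "finite ?T" by simp
  then show ?thesis
    using Poly_Mapping.keys_add[of P Q]
    by (simp add: poly_eval_superset[of ?T] lookup_add distrib_right sum.distrib)
qed

lemma poly_in_add: "poly_in V P \<Longrightarrow> poly_in V Q \<Longrightarrow> poly_in V (P + Q)"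
  using Poly_Mapping.keys_add[of P Q] by (auto simp: poly_in_def)

lemma ex_poly_monomial:
  assumes "finite V" "Poly_Mapping.keys e \<subseteq> V"
  shows "\<exists>P. poly_in V P \<and> (\<forall>v. poly_eval P v = r * (\<Prod>X\<in>V. v X ^ Poly_Mapping.lookup e X))"
proof (intro exI conjI allI)
  show "poly_in V (Poly_Mapping.single e r)"
    using assms(2) by (simp add: poly_in_def)
  fix v :: "'a \<Rightarrow> complex"
  have "(\<Prod>X\<in>Poly_Mapping.keys e. v X ^ Poly_Mapping.lookup e X) =
      (\<Prod>X\<in>V. v X ^ Poly_Mapping.lookup e X)"
    using assms by (intro prod.mono_neutral_left) (auto simp: in_keys_iff)
  then show "poly_eval (Poly_Mapping.single e r) v = r * (\<Prod>X\<in>V. v X ^ Poly_Mapping.lookup e X)"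
    by (simp add: poly_eval_superset[of "{e}"])
qed

lemma ex_poly_sum:
  assumes "\<And>i. i \<in> I \<Longrightarrow> \<exists>P. poly_in V P \<and> (\<forall>v. poly_eval P v = F i v)"
  shows "\<exists>P. poly_in V P \<and> (\<forall>v. poly_eval P v = (\<Sum>i\<in>I. F i v))"
proof -
  have 0: "\<exists>P. poly_in V P \<and> (\<forall>v. poly_eval P v = 0)"
    by (rule exI[of _ 0]) (simp add: poly_in_def poly_eval_def)
  show ?thesis
    using assms
  proof (induction I rule: infinite_finite_induct)
    case (insert i I)
    then obtain P Q where "poly_in V P" "\<forall>v. poly_eval P v = F i v"
      "poly_in V Q" "\<forall>v. poly_eval Q v = (\<Sum>i\<in>I. F i v)"
      by (metis insertCI)
    with insert.hyps show ?case
      by (intro exI[of _ "P + Q"]) (simp add: poly_in_add poly_eval_add)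
  qed (use 0 in simp_all)
qed

text \<open>Supplies a polynomial for step 2 when a multiple of the series has to be exhibited as a
  base vector.\<close>

lemma ex_poly_gt_val:
  "\<exists>P. poly_in S3 P \<and> (\<forall>v. poly_eval P v = r * gt_val c p a b n v)"
proof -
  define F where "F i v = r * (dpow (c + p) p (v [P1']) (v [N2', N1']) *
    (dpow a i (v [N2']) (v [N1']) * dpow b (n - i) (v [N2', P1']) (v [N1', P1'])))"
    for i and v :: "idx3 list \<Rightarrow> complex"
  have "\<exists>P. poly_in S3 P \<and> (\<forall>v. poly_eval P v = F i v)" for i
  proof (cases "i \<le> a \<and> n - i \<le> b")
    case True
    define e where "e = Poly_Mapping.single [P1'] c + Poly_Mapping.single [N2', N1'] p +
      Poly_Mapping.single [N2'] (a - i) + Poly_Mapping.single [N1'] i +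
      Poly_Mapping.single [N2', P1'] (b - (n - i)) + Poly_Mapping.single [N1', P1'] (n - i)"
    have "Poly_Mapping.keys e \<subseteq> S3"
      by (auto simp: e_def in_keys_iff lookup_add lookup_single S3_def when_def split: if_splits)
    from ex_poly_monomial[OF _ this, of "r / (fact c * fact p * fact (a - i) * fact i *
        fact (b - (n - i)) * fact (n - i))"]
    show ?thesis
      using True by (simp add: S3_def e_def lookup_add lookup_single F_def dpow_def mult_ac)
  next
    case False
    then have "F i v = 0" for v
      by (auto simp: F_def dpow_eq_0)
    then show ?thesis
      by (intro exI[of _ 0]) (simp add: poly_in_def poly_eval_def)
  qed
  from ex_poly_sum[of "{..n}" S3 F, OF this] show ?thesis
    by (simp add: F_def gt_val_def sum_distrib_left)
qed

lemma a3_cong_rows: "(\<And>j. g $ N2' $ j = h $ N2' $ j \<and> g $ N1' $ j = h $ N1' $ j) \<Longrightarrow> a3 X g = a3 X h"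
  by (cases "(N2', N1', X, g)" rule: minor.cases) (simp_all add: a3_def)

text \<open>Here the ambiguity of \<open>P\<close> disappears: the identity on \<open>GL3\<close>
  becomes one for all 3 x 3 matrices, hence for the minors of any \<open>G\<close>.\<close>

lemma poly_eval_transfer:
  assumes "on_group GL3 (\<lambda>g. poly_eval P (\<lambda>X. a3 X g)) = sfun r (on_group GL3 (gt_fun c p a b n))"
  shows "poly_eval P (\<lambda>X. a4 (map incl X) G) = r * gt_val c p a b n (\<lambda>X. a4 (map incl X) G)"
proof -
  define \<phi> where "\<phi> = (\<lambda>g. poly_eval P (\<lambda>X. a3 X g) - r * gt_fun c p a b n g)"
  have pf: "polyfun (a3 X)" for X
  proof -
    have "polyfun (\<lambda>g. a3 X g)"
      by (cases "(N2', N1', X, mat 1 :: complex^idx3^idx3)" rule: minor.cases)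
        (auto simp: a3_def intro!: polyfun_diff polyfun.intros)
    then show ?thesis by simp
  qed
  have 0: "\<phi> g = 0" for g
  proof (rule polyfun_eq_0_if_generic)
    show "polyfun \<phi>"
      unfolding \<phi>_def poly_eval_def
      by (intro polyfun_diff polyfun_sum polyfun_mult polyfun_const polyfun_prod polyfun_power pf
          polyfun_gt_fun)
    fix g
    assume gen: "a3 [N2', N1'] g \<noteq> 0"
    \<comment> \<open>The determinants see only the first two rows; replacing the third by
      \<open>(0, 0, 1)\<close> makes the matrix invertible when \<open>a3 [N2', N1']\<close> is
      nonzero.\<close>
    define h where "h = mat3 (g $ N2' $ N2') (g $ N2' $ N1') (g $ N2' $ P1')
      (g $ N1' $ N2') (g $ N1' $ N1') (g $ N1' $ P1') 0 0 1"
    have "g $ N2' $ j = h $ N2' $ j \<and> g $ N1' $ j = h $ N1' $ j" for j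
      by (cases j) (simp_all add: h_def)
    then have "a3 X g = a3 X h" for X by (rule a3_cong_rows)
    then have "\<phi> g = \<phi> h" by (simp add: \<phi>_def gt_fun_def)
    moreover have "h \<in> GL3"
      unfolding h_def by (rule mat3_in_GL3) (use gen in \<open>simp add: a3_def mult_ac\<close>)
    then have "\<phi> h = 0"
      using fun_cong[OF assms, of h] by (simp add: on_group_def sfun_def \<phi>_def)
    ultimately show "\<phi> g = 0" by simp
  qed
  \<comment> \<open>This submatrix may be singular even for invertible \<open>G\<close>.\<close>
  define g where "g = (\<chi> i j. G $ incl i $ incl j)"
  have "a3 X g = a4 (map incl X) G" for X
    by (cases "(N2', N1', X, g)" rule: minor.cases) (simp_all add: a3_def a4_def g_def)
  then show ?thesis
    using 0[of g] by (simp add: \<phi>_def gt_fun_def)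
qed


section \<open>Lowering with respect to \<open>sp\<^sub>2\<close>\<close>

text \<open>
  The nested convolution distributes \<open>k\<close> applications of \<^term>\<open>Emat P2 N2\<close> over the three
  determinants of \<open>S3\<close> that contain \<open>-2\<close>; the other three are killed.
\<close>

definition sp_term :: "nat \<Rightarrow> nat \<Rightarrow> nat \<Rightarrow> nat \<Rightarrow> complex^idx4^idx4 \<Rightarrow> complex" where
  "sp_term e p q = conv (conv (\<lambda>j g. dpow e j (a4 [N2] g) (a4 [P2] g))
      (\<lambda>j g. dpow p j (a4 [N2, N1] g) (a4 [P2, N1] g)))
      (\<lambda>j g. dpow q j (a4 [N2, P1] g) (a4 [P2, P1] g))"

text \<open>The lowering acts on each monomial of \<open>gt_val\<close> separately. The index set
  drops the vanishing monomials, so \<open>a - i\<close> and \<open>b - (n - i)\<close> are genuine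
  differences.\<close>

definition sp_fun ::
  "nat \<Rightarrow> nat \<Rightarrow> nat \<Rightarrow> nat \<Rightarrow> nat \<Rightarrow> nat \<Rightarrow> complex^idx4^idx4 \<Rightarrow> complex"
where
  "sp_fun c p a b n k g = (\<Sum>i\<in>{i. i \<le> n \<and> i \<le> a \<and> n - i \<le> b}.
     a4 [P1] g ^ c / fact c * (a4 [N1] g ^ i / fact i) * (a4 [N1, P1] g ^ (n - i) / fact (n - i)) *
     sp_term (a - i) p (b - (n - i)) k g)"

lemma sp_fun_0: "sp_fun c p a b n 0 g = gt_val c p a b n (\<lambda>X. a4 (map incl X) g)"
proof -
  let ?t = "\<lambda>i. dpow (c + p) p (a4 [P1] g) (a4 [N2, N1] g) *
    (dpow a i (a4 [N2] g) (a4 [N1] g) * dpow b (n - i) (a4 [N2, P1] g) (a4 [N1, P1] g))"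
  have "sp_fun c p a b n 0 g = (\<Sum>i\<in>{i. i \<le> n \<and> i \<le> a \<and> n - i \<le> b}. ?t i)"
    unfolding sp_fun_def
    by (intro sum.cong) (auto simp: sp_term_def conv_def dpow_def mult_ac)
  also have "\<dots> = (\<Sum>i\<le>n. ?t i)"
    by (intro sum.mono_neutral_left) (auto simp: dpow_def)
  finally show ?thesis by (simp add: gt_val_def sum_distrib_left)
qed

lemma lder_a4:
  "lder (Emat P2 N2) (a4 [N2]) (\<lambda>g. 1 * a4 [P2] g)"
  "lder (Emat P2 N2) (a4 [N1]) (\<lambda>g. 0)"
  "lder (Emat P2 N2) (a4 [P1]) (\<lambda>g. 0)"
  "lder (Emat P2 N2) (a4 [P2]) (\<lambda>g. 0)"
  "lder (Emat P2 N2) (a4 [N2, N1]) (\<lambda>g. 1 * a4 [P2, N1] g)"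
  "lder (Emat P2 N2) (a4 [N2, P1]) (\<lambda>g. 1 * a4 [P2, P1] g)"
  "lder (Emat P2 N2) (a4 [P2, N1]) (\<lambda>g. 0)"
  "lder (Emat P2 N2) (a4 [P2, P1]) (\<lambda>g. 0)"
  "lder (Emat P2 N2) (a4 [N1, P1]) (\<lambda>g. 0)"
  unfolding a4_def
  by ((rule lder_cong[OF lder_minor1], simp; fail) | (rule lder_cong[OF lder_minor2], simp; fail))+

lemma lder_divided_power_0:
  assumes "lder X x (\<lambda>g. 0)"
  shows "lder X (\<lambda>g. x g ^ n / fact n) (\<lambda>g. 0)"
  by (rule lder_cong[OF lder_divided_power[OF assms]]) simp

lemma lder_mult_0:
  assumes "lder X f (\<lambda>g. 0)" "lder X h (\<lambda>g. 0)"
  shows "lder X (\<lambda>g. f g * h g) (\<lambda>g. 0)"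
  by (rule lder_cong[OF lder_mult[OF assms]]) simp

lemma lder_sp_term:
  "lder (Emat P2 N2) (sp_term e p q k) (\<lambda>g. 1 * of_nat (Suc k) * sp_term e p q (Suc k) g)"
  unfolding sp_term_def
  by (intro lder_conv_lower lder_dpow_lower lder_a4)

lemma lder_sp_fun:
  "lder (Fmat P2 N2) (sp_fun c p a b n k) (\<lambda>g. 2 * of_nat (Suc k) * sp_fun c p a b n (Suc k) g)"
proof -
  \<comment> \<open>Negating and swapping the indices fixes the pair \<open>(2, -2)\<close>, and the
    product of signs is -1, so both terms of \<open>Fmat\<close> agree.\<close>
  have "Fmat P2 N2 = smat 2 (Emat P2 N2)"
    by (simp add: Fmat_def vec_eq_iff)
  moreover have *: "lder (Emat P2 N2) (sp_fun c p a b n k)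
      (\<lambda>g. of_nat (Suc k) * sp_fun c p a b n (Suc k) g)"
    unfolding sp_fun_def
    by (rule lder_cong[OF lder_sum[OF lder_mult[OF lder_mult_0[OF lder_mult_0[OF
        lder_divided_power_0[OF lder_a4(3)] lder_divided_power_0[OF lder_a4(2)]]
        lder_divided_power_0[OF lder_a4(9)]] lder_sp_term]]])
      (simp add: sum_distrib_left mult_ac)
  ultimately show ?thesis
    using lder_smat_left[OF *, of 2] by (simp only: mult.assoc)
qed

lemma Fmat_in_sp4: "Fmat i j \<in> sp4"
  unfolding sp4_def by (rule cmat.span_base) blast

text \<open>The factor \<open>fact k\<close> will cancel the factorial of step 3; the factor
  \<open>2 ^ k\<close> stays in the scalar.\<close>

lemma lie_act_Sp4_sp_fun:
  "(lie_act Sp4 (Fmat P2 N2) ^^ k) (on_group Sp4 (\<lambda>g. r * sp_fun c p a b n 0 g)) =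
    on_group Sp4 (\<lambda>g. r * 2 ^ k * fact k * sp_fun c p a b n k g)"
proof (induction k)
  case (Suc k)
  have "(lie_act Sp4 (Fmat P2 N2) ^^ Suc k) (on_group Sp4 (\<lambda>g. r * sp_fun c p a b n 0 g)) =
      on_group Sp4 (\<lambda>g. r * 2 ^ k * fact k * (2 * of_nat (Suc k) * sp_fun c p a b n (Suc k) g))"
    unfolding funpow.simps o_apply Suc.IH
    by (rule lie_act_Sp4[OF lder_cmult[OF lder_sp_fun] Fmat_in_sp4])
  also have "\<dots> = on_group Sp4 (\<lambda>g. r * 2 ^ Suc k * fact (Suc k) * sp_fun c p a b n (Suc k) g)"
    by (simp add: algebra_simps)
  finally show ?case .
qed simp


section \<open>The Gamma-series as a finite sum\<close>

lemma rGamma_of_int_plus_1: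
  "rGamma (of_int j + 1 :: complex) = (if j < 0 then 0 else 1 / fact (nat j))"
proof (cases "j < 0")
  case True
  then have "(of_int (j + 1) :: complex) \<in> \<int>\<^sub>\<le>\<^sub>0"
    by (intro nonpos_Ints_of_int) simp
  then show ?thesis using True by (simp add: rGamma_eq_zero_iff)
next
  case False
  then obtain m where "j = int m" using zero_le_imp_eq_int[of j] by auto
  then show ?thesis
    using Gamma_fact[of m, where ?'a = complex] by (simp add: rGamma_inverse_Gamma add_ac inverse_eq_divide)
qed

lemma sum_S4:
  "(\<Sum>X\<in>S4. F X) = F [N2] + F [N1] + F [P1] + F [P2] + F [N2, N1] + F [N2, P1] + F [P2, N1] +
     F [P2, P1] + (F [N1, P1] :: 'a :: comm_monoid_add)"
  by (simp add: S4_def add_ac)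

lemma prod_S4:
  "(\<Prod>X\<in>S4. F X) = F [N2] * F [N1] * F [P1] * F [P2] * F [N2, N1] * F [N2, P1] * F [P2, N1] *
     F [P2, P1] * (F [N1, P1] :: 'a :: comm_monoid_mult)"
  by (simp add: S4_def mult_ac)

lemma finite_S4: "finite S4"
  by (simp add: S4_def)

lemma gtz_lattice_iff:
  "p \<in> gtz_lattice m2 m1 k2 k1 h2 h1 \<longleftrightarrow> p \<in> S4 \<rightarrow>\<^sub>E UNIV \<and>
    p [N2] + p [N1] + p [P1] + p [P2] + p [N2, N1] + p [N2, P1] + p [P2, N1] + p [P2, P1] +
      p [N1, P1] = int m2 \<and>
    p [N2, N1] + p [N2, P1] + p [P2, N1] + p [P2, P1] + p [N1, P1] = int m1 \<and>
    p [N2] + p [N1] + p [P2] + p [N2, N1] + p [N2, P1] + p [P2, N1] + p [P2, P1] + p [N1, P1] =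
      int k2 \<and>
    p [N2, N1] + p [P2, N1] = int k1 \<and>
    p [N2] + p [P2] + p [N2, N1] + p [N2, P1] + p [P2, N1] + p [P2, P1] = int h2 \<and>
    p [N2] + p [N2, N1] + p [N2, P1] = int h1"
  unfolding gtz_lattice_def mem_Collect_eq sum.inter_filter[OF finite_S4] sum_S4 by simp

text \<open>Six equations in nine unknowns leave three parameters: \<open>i\<close> and
  \<open>j\<close> are the exponents at \<open>[N1]\<close> and \<open>[P2]\<close>, and
  \<open>s\<close> is the sum of those at \<open>[P2]\<close> and \<open>[P2, N1]\<close>. They are
  the summation indices of \<open>sp_fun\<close> and of the nested convolution in
  \<open>sp_term\<close>.\<close>

definition gtz_point ::
  "nat \<Rightarrow> nat \<Rightarrow> nat \<Rightarrow> nat \<Rightarrow> nat \<Rightarrow> nat \<Rightarrow> nat \<times> nat \<times> nat \<Rightarrow> idx4 list \<Rightarrow> int"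
where
  "gtz_point c p a b n k = (\<lambda>(i, s, j). (\<lambda>X\<in>S4.
     if X = [N2] then int a - int i - int j
     else if X = [P2] then int j
     else if X = [N1] then int i
     else if X = [P1] then int c
     else if X = [N2, N1] then int p - (int s - int j)
     else if X = [P2, N1] then int s - int j
     else if X = [N2, P1] then int b - (int n - int i) - (int k - int s)
     else if X = [P2, P1] then int k - int s
     else int n - int i))"

lemma gtz_point_nth:
  "gtz_point c p a b n k (i, s, j) [N2] = int a - int i - int j"
  "gtz_point c p a b n k (i, s, j) [P2] = int j"
  "gtz_point c p a b n k (i, s, j) [N1] = int i"
  "gtz_point c p a b n k (i, s, j) [P1] = int c"
  "gtz_point c p a b n k (i, s, j) [N2, N1] = int p - (int s - int j)"
  "gtz_point c p a b n k (i, s, j) [P2, N1] = int s - int j"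
  "gtz_point c p a b n k (i, s, j) [N2, P1] = int b - (int n - int i) - (int k - int s)"
  "gtz_point c p a b n k (i, s, j) [P2, P1] = int k - int s"
  "gtz_point c p a b n k (i, s, j) [N1, P1] = int n - int i"
  by (simp_all add: gtz_point_def S4_def)

lemma gtz_series_sp_fun:
  assumes "h2 + n = a + b + p" "h1 + k = h2"
  shows "(\<Sum>\<^sub>\<infinity>q \<in> gtz_lattice (c + a + p + b) (p + b) (a + b + p) p h2 h1.
       \<Prod>X\<in>S4. a4 X g powi q X * rGamma (of_int (q X) + 1)) = sp_fun c p a b n k g"
proof -
  let ?L = "gtz_lattice (c + a + p + b) (p + b) (a + b + p) p h2 h1"
  let ?F = "\<lambda>q. \<Prod>X\<in>S4. a4 X g powi q X * rGamma (of_int (q X) + 1)"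
  \<comment> \<open>Outside \<open>T\<close> some exponent is negative and its factor
    \<open>rGamma\<close> makes the term 0.\<close>
  define T where "T = {q \<in> ?L. \<forall>X\<in>S4. q X \<ge> 0}"
  define I\<^sub>1 where "I\<^sub>1 = {i. i \<le> n \<and> i \<le> a \<and> n - i \<le> b}"
  define J where "J i = {(s, j). s \<le> k \<and> j \<le> s \<and> j \<le> a - i \<and> s - j \<le> p \<and> k - s \<le> b - (n - i)}" for i
  define I where "I = Sigma I\<^sub>1 J"
  have fin: "finite I\<^sub>1" "finite (J i)" for i
  proof -
    show "finite I\<^sub>1" by (simp add: I\<^sub>1_def)
    have "J i \<subseteq> {..k} \<times> {..k}" by (auto simp: J_def)
    then show "finite (J i)" by (rule finite_subset) simp
  qed
  have bij: "bij_betw (gtz_point c p a b n k) I T"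
  proof (rule bij_betw_byWitness[where f' = "\<lambda>q. (nat (q [N1]), nat (q [P2] + q [P2, N1]), nat (q [P2]))"])
    show "\<forall>x\<in>I. (nat (gtz_point c p a b n k x [N1]),
        nat (gtz_point c p a b n k x [P2] + gtz_point c p a b n k x [P2, N1]),
        nat (gtz_point c p a b n k x [P2])) = x"
      by (simp add: gtz_point_nth split_paired_all)
    show "\<forall>q\<in>T. gtz_point c p a b n k
        (nat (q [N1]), nat (q [P2] + q [P2, N1]), nat (q [P2])) = q"
    proof
      fix q assume "q \<in> T"
      then have ext: "q \<in> S4 \<rightarrow>\<^sub>E UNIV" and eqs: "q \<in> ?L" and pos: "\<And>X. X \<in> S4 \<Longrightarrow> q X \<ge> 0"
        by (auto simp: T_def gtz_lattice_iff)
      show "gtz_point c p a b n k (nat (q [N1]), nat (q [P2] + q [P2, N1]), nat (q [P2])) = q"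
      proof (rule PiE_ext[OF _ ext])
        show "gtz_point c p a b n k (nat (q [N1]), nat (q [P2] + q [P2, N1]), nat (q [P2])) \<in> S4 \<rightarrow>\<^sub>E UNIV"
          by (simp add: gtz_point_def)
        show "gtz_point c p a b n k (nat (q [N1]), nat (q [P2] + q [P2, N1]), nat (q [P2])) X = q X"
          if X: "X \<in> S4" for X
        proof -
          have nat: "int (nat (q [N1])) = q [N1]" "int (nat (q [P2])) = q [P2]"
            "int (nat (q [P2] + q [P2, N1])) = q [P2] + q [P2, N1]"
            using pos by (auto simp: S4_def)
          have lin: "int h2 + int n = int a + int b + int p" "int h1 + int k = int h2"
            using assms by linarith+
          show ?thesis
            using X[unfolded S4_def] eqs[unfolded gtz_lattice_iff of_nat_add] lin
            by (elim insertE emptyE; simp only: gtz_point_nth nat; linarith)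
        qed
      qed
    qed
    show "gtz_point c p a b n k ` I \<subseteq> T"
    proof safe
      fix i s j assume "(i, s, j) \<in> I"
      then have "i \<le> n" "i \<le> a" "n - i \<le> b" "s \<le> k" "j \<le> s" "j \<le> a - i" "s - j \<le> p"
        "k - s \<le> b - (n - i)"
        by (auto simp: I_def I\<^sub>1_def J_def)
      then have le: "int i \<le> int n" "int i \<le> int a" "int n - int i \<le> int b" "int s \<le> int k"
        "int j \<le> int s" "int j \<le> int a - int i" "int s - int j \<le> int p"
        "int k - int s \<le> int b - (int n - int i)"
        by linarith+
      have "int h2 + int n = int a + int b + int p" "int h1 + int k = int h2"
        using assms by linarith+
      then have "gtz_point c p a b n k (i, s, j) \<in> ?L"
        unfolding gtz_lattice_iff gtz_point_nth of_nat_add by (auto simp: gtz_point_def)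
      moreover have "\<forall>X\<in>S4. gtz_point c p a b n k (i, s, j) X \<ge> 0"
        using le unfolding S4_def by (simp add: gtz_point_nth)
      ultimately show "gtz_point c p a b n k (i, s, j) \<in> T" by (simp add: T_def)
    qed
    show "(\<lambda>q. (nat (q [N1]), nat (q [P2] + q [P2, N1]), nat (q [P2]))) ` T \<subseteq> I"
    proof safe
      fix q assume "q \<in> T"
      then have eqs: "q \<in> ?L" and pos: "\<And>X. X \<in> S4 \<Longrightarrow> q X \<ge> 0"
        by (auto simp: T_def)
      have "q [N2] \<ge> 0" "q [N1] \<ge> 0" "q [P1] \<ge> 0" "q [P2] \<ge> 0" "q [N2, N1] \<ge> 0" "q [N2, P1] \<ge> 0"
        "q [P2, N1] \<ge> 0" "q [P2, P1] \<ge> 0" "q [N1, P1] \<ge> 0"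
        by (auto intro!: pos simp: S4_def)
      then obtain x y z x' A B A' B' C where q: "q [N2] = int x" "q [N1] = int y" "q [P1] = int z"
        "q [P2] = int x'" "q [N2, N1] = int A" "q [N2, P1] = int B" "q [P2, N1] = int A'"
        "q [P2, P1] = int B'" "q [N1, P1] = int C"
        by (meson zero_le_imp_eq_int)
      have "int h2 + int n = int a + int b + int p" "int h1 + int k = int h2"
        using assms by linarith+
      \<comment> \<open>The lattice equations are solved additively, which avoids truncated
        subtraction on returning to natural numbers.\<close>
      then have "int a = int (x + x' + y)" "int p = int (A + A')" "int n = int (y + C)"
        "int b = int (B + B' + C)" "int k = int (x' + A' + B')"
        using eqs unfolding gtz_lattice_iff q of_nat_add by linarith+
      then have "a = x + x' + y" "p = A + A'" "n = y + C" "b = B + B' + C" "k = x' + A' + B'"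
        by (simp_all only: of_nat_eq_iff)
      then show "(nat (q [N1]), nat (q [P2] + q [P2, N1]), nat (q [P2])) \<in> I"
        unfolding I_def I\<^sub>1_def J_def q by (simp add: nat_int_add)
    qed
  qed
  have "infsum ?F ?L = infsum ?F T"
  proof (rule infsum_cong_neutral)
    fix q assume "q \<in> ?L - T"
    then obtain X where "X \<in> S4" "q X < 0" by (auto simp: T_def not_le)
    then show "?F q = 0"
      using finite_S4 by (intro prod_zero) (auto simp: rGamma_of_int_plus_1)
  qed (auto simp: T_def)
  also have "\<dots> = sum ?F T"
    using bij_betw_finite[OF bij] fin by (simp add: I_def)
  also have "\<dots> = (\<Sum>x\<in>I. ?F (gtz_point c p a b n k x))"
    by (rule sum.reindex_bij_betw[OF bij, symmetric])
  also have "\<dots> = (\<Sum>(i, s, j)\<in>I.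
      a4 [P1] g ^ c / fact c * (a4 [N1] g ^ i / fact i) * (a4 [N1, P1] g ^ (n - i) / fact (n - i)) *
      (dpow (a - i) j (a4 [N2] g) (a4 [P2] g) * dpow p (s - j) (a4 [N2, N1] g) (a4 [P2, N1] g) *
        dpow (b - (n - i)) (k - s) (a4 [N2, P1] g) (a4 [P2, P1] g)))"
  proof (rule sum.cong[OF refl], clarify)
    fix i s j assume "(i, s, j) \<in> I"
    then have le: "i \<le> n" "i \<le> a" "n - i \<le> b" "s \<le> k" "j \<le> s" "j \<le> a - i" "s - j \<le> p"
      "k - s \<le> b - (n - i)"
      by (auto simp: I_def I\<^sub>1_def J_def)
    have vals: "gtz_point c p a b n k (i, s, j) [N2] = int (a - i - j)"
      "gtz_point c p a b n k (i, s, j) [P2] = int j"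
      "gtz_point c p a b n k (i, s, j) [N1] = int i"
      "gtz_point c p a b n k (i, s, j) [P1] = int c"
      "gtz_point c p a b n k (i, s, j) [N2, N1] = int (p - (s - j))"
      "gtz_point c p a b n k (i, s, j) [P2, N1] = int (s - j)"
      "gtz_point c p a b n k (i, s, j) [N2, P1] = int (b - (n - i) - (k - s))"
      "gtz_point c p a b n k (i, s, j) [P2, P1] = int (k - s)"
      "gtz_point c p a b n k (i, s, j) [N1, P1] = int (n - i)"
      unfolding gtz_point_nth using le by linarith+
    show "?F (gtz_point c p a b n k (i, s, j)) =
      a4 [P1] g ^ c / fact c * (a4 [N1] g ^ i / fact i) * (a4 [N1, P1] g ^ (n - i) / fact (n - i)) *
      (dpow (a - i) j (a4 [N2] g) (a4 [P2] g) * dpow p (s - j) (a4 [N2, N1] g) (a4 [P2, N1] g) *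
        dpow (b - (n - i)) (k - s) (a4 [N2, P1] g) (a4 [P2, P1] g))"
      unfolding prod_S4 rGamma_of_int_plus_1 vals dpow_def using le
      by (simp add: mult_ac del: of_nat_diff)
  qed
  also have "\<dots> = (\<Sum>i\<in>I\<^sub>1.
      a4 [P1] g ^ c / fact c * (a4 [N1] g ^ i / fact i) * (a4 [N1, P1] g ^ (n - i) / fact (n - i)) *
      (\<Sum>(s, j)\<in>J i. dpow (a - i) j (a4 [N2] g) (a4 [P2] g) *
        dpow p (s - j) (a4 [N2, N1] g) (a4 [P2, N1] g) *
        dpow (b - (n - i)) (k - s) (a4 [N2, P1] g) (a4 [P2, P1] g)))"
    unfolding I_def using fin
    by (subst sum.Sigma[symmetric]) (simp_all add: sum_distrib_left case_prod_beta')
  also have "\<dots> = sp_fun c p a b n k g"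
    unfolding sp_fun_def I\<^sub>1_def[symmetric]
  proof (intro sum.cong refl arg_cong[of _ _ "(*) _"])
    fix i
    let ?t = "\<lambda>s j. dpow (a - i) j (a4 [N2] g) (a4 [P2] g) *
        dpow p (s - j) (a4 [N2, N1] g) (a4 [P2, N1] g) *
        dpow (b - (n - i)) (k - s) (a4 [N2, P1] g) (a4 [P2, P1] g)"
    \<comment> \<open>On the rest of the triangle \<open>j \<le> s \<le> k\<close> some
      \<open>dpow\<close> has its index beyond its degree and is 0.\<close>
    have "(\<Sum>(s, j)\<in>J i. ?t s j) = (\<Sum>(s, j)\<in>Sigma {..k} (\<lambda>s. {..s}). ?t s j)"
      by (intro sum.mono_neutral_left) (auto simp: J_def dpow_def split: if_splits)
    also have "\<dots> = (\<Sum>s\<le>k. \<Sum>j\<le>s. ?t s j)"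
      by (rule sum.Sigma[symmetric]) auto
    also have "\<dots> = sp_term (a - i) p (b - (n - i)) k g"
      by (simp add: sp_term_def conv_def sum_distrib_right)
    finally show "(\<Sum>(s, j)\<in>J i. ?t s j) = sp_term (a - i) p (b - (n - i)) k g" .
  qed
  finally show ?thesis .
qed

theorem theorem2:
  fixes m2 m1 k2 k1 h2 h1 :: nat
    and f :: "complex^idx4^idx4 \<Rightarrow> complex"
  assumes "m2 \<ge> k2" "k2 \<ge> m1" "m1 \<ge> k1"
    and "k2 \<ge> h2" "h2 \<ge> k1"
    and "h2 \<ge> h1"
  shows "gtz_base_vector m2 m1 k2 k1 h2 h1 f \<longleftrightarrow>
    (\<exists>c. c \<noteq> 0 \<and> f = sfun c (gtz_series m2 m1 k2 k1 h2 h1))"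
proof -
  define c a b n k where "c = m2 - k2" "a = k2 - m1" "b = m1 - k1" "n = k2 - h2" "k = h2 - h1"
  have par: "m2 = c + a + k1 + b" "m1 = k1 + b" "k2 = a + b + k1" "h2 + n = a + b + k1" "n \<le> a + b"
    "h1 + k = h2"
    using assms by (auto simp: c_a_b_n_k_def)
  let ?U = "on_group GL3 (gt_fun c k1 a b n)"
  have gt: "gt_vector m2 m1 k2 k1 h2 w \<longleftrightarrow> (\<exists>r. r \<noteq> 0 \<and> w = sfun r ?U)" for w
    using gt_vector_iff[OF par(4,5), of c w] par(1-3) by simp
  have series: "gtz_series m2 m1 k2 k1 h2 h1 = on_group Sp4 (sp_fun c k1 a b n k)"
    using gtz_series_sp_fun[OF par(4,6), where c = c] par(1-3) by (simp add: gtz_series_def)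
  have lower: "sfun (1 / fact (h2 - h1)) ((lie_act Sp4 (Fmat P2 N2) ^^ (h2 - h1))
      (on_group Sp4 (\<lambda>g. poly_eval P (\<lambda>X. a4 (map incl X) g)))) =
      sfun (r * 2 ^ k) (gtz_series m2 m1 k2 k1 h2 h1)"
    if "on_group GL3 (\<lambda>g. poly_eval P (\<lambda>X. a3 X g)) = sfun r ?U" for P r
    unfolding poly_eval_transfer[OF that] sp_fun_0[symmetric] c_a_b_n_k_def(5)[symmetric]
      lie_act_Sp4_sp_fun series on_group_cmult[symmetric]
    by (simp add: mult_ac)
  show ?thesis
  proof
    assume "gtz_base_vector m2 m1 k2 k1 h2 h1 f"
    then obtain w P r where "r \<noteq> 0" "w = sfun r ?U" "w = on_group GL3 (\<lambda>g. poly_eval P (\<lambda>X. a3 X g))"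
      and f: "f = sfun (1 / fact (h2 - h1)) ((lie_act Sp4 (Fmat P2 N2) ^^ (h2 - h1))
        (on_group Sp4 (\<lambda>g. poly_eval P (\<lambda>X. a4 (map incl X) g))))"
      unfolding gtz_base_vector_def gt by (elim exE conjE)
    then have r: "r \<noteq> 0" "on_group GL3 (\<lambda>g. poly_eval P (\<lambda>X. a3 X g)) = sfun r ?U"
      by simp_all
    have "f = sfun (r * 2 ^ k) (gtz_series m2 m1 k2 k1 h2 h1)"
      unfolding f by (rule lower[OF r(2)])
    moreover have "r * 2 ^ k \<noteq> 0" using r(1) by simp
    ultimately show "\<exists>c. c \<noteq> 0 \<and> f = sfun c (gtz_series m2 m1 k2 k1 h2 h1)" by blast
  next
    assume "\<exists>c. c \<noteq> 0 \<and> f = sfun c (gtz_series m2 m1 k2 k1 h2 h1)"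
    then obtain s where s: "s \<noteq> 0" "f = sfun s (gtz_series m2 m1 k2 k1 h2 h1)" by blast
    \<comment> \<open>Compensates the factor \<open>2 ^ k\<close> produced by the lowering.\<close>
    define r where "r = s / 2 ^ k"
    obtain P where P: "poly_in S3 P" "\<And>v. poly_eval P v = r * gt_val c k1 a b n v"
      using ex_poly_gt_val by blast
    have w: "on_group GL3 (\<lambda>g. poly_eval P (\<lambda>X. a3 X g)) = sfun r ?U"
      unfolding P(2) gt_fun_def[symmetric] on_group_cmult ..
    show "gtz_base_vector m2 m1 k2 k1 h2 h1 f"
      unfolding gtz_base_vector_def gt
    proof (intro exI conjI)
      show "r \<noteq> 0" using s(1) by (simp add: r_def)
      show "sfun r ?U = on_group GL3 (\<lambda>g. poly_eval P (\<lambda>X. a3 X g))" by (rule w[symmetric])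
      show "f = sfun (1 / fact (h2 - h1)) ((lie_act Sp4 (Fmat P2 N2) ^^ (h2 - h1))
          (on_group Sp4 (\<lambda>g. poly_eval P (\<lambda>X. a4 (map incl X) g))))"
        unfolding lower[OF w] s(2) r_def by simp
    qed (rule refl, rule P(1))
  qed
qed

end
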